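(* Let $K$ be a field and let $(\rho_i)_{i\ge 0}$ be an essential continuous MacLane chain of valuations on $K[x]$, with $\rho_i=[\rho_{i-1};\chi_i,\beta_i]$ for all $i\ge 1$, and with stable value group $\Gamma_\infty$. If the sequence $(\beta_i)_{i\ge 1}$ is unbounded in $\Gamma_\infty$ (that is, it admits no upper bound in $\Gamma_\infty$), then $$t_\infty\, b_\infty=\operatorname{mult}(\phi)\qquad\text{for every MLV limit key polynomial }\phi\in \mathrm{KP}_\infty\big((\rho_i)_{i\ge 0}\big).$$
   Context: Valuations. A valuation $\nu$ on $K[x]$ is a map $\nu\colon K[x]\to\Lambda\cup\{\infty\}$ ($\Lambda$ a totally ordered abelian group) with $\nu(fg)=\nu(f)+\nu(g)$, $\nu(f+g)\ge\min\{\nu(f),\nu(g)\}$, whose restriction to $K$ is a valuation of the field $K$. Its value group $\Gamma_\nu$ is generated by the finite values of $\nu$; $(\Gamma_\nu)_{\mathbb Q}=\Gamma_\nu\otimes\mathbb Q$. For valuations, $\mu\le\nu$ means $\mu(f)\le\nu(f)$ for all $f\in K[x]$. MLV key polynomials. Let $\mathcal P_\alpha=\{g:\nu(g)\ge\alpha\}\supset\mathcal P_\alpha^+=\{g:\nu(g)>\alpha\}$, and let $\mathcal G_\nu=\bigoplus_{\alpha\in\Gamma_\nu}\mathcal P_\alpha/\mathcal P_\alpha^+$ be the graded algebra, with $\operatorname{in}_\nu g=g+\mathcal P_{\nu(g)}^+$ if $\nu(g)<\infty$, and $\operatorname{in}_\nu g=0$ otherwise. Write $h\mid_\nu g$ if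 $\operatorname{in}_\nu h$ divides $\operatorname{in}_\nu g$ in $\mathcal G_\nu$. A MacLane-Vaquié (MLV) key polynomial for $\nu$ is a monic $g\in K[x]$ such that $(\operatorname{in}_\nu g)\mathcal G_\nu$ is a non-zero prime ideal and $g\nmid_\nu f$ for every non-zero $f$ with $\deg f<\deg g$. The set of these is $\mathrm{KP}(\nu)$. Ordinary augmentation. If $\chi\in\mathrm{KP}(\rho)$ and $\beta>\rho(\chi)$ lies in an ordered group containing $\Gamma_\rho$, then $[\rho;\chi,\beta]$ is the valuation sending $f=\sum_{s}a_s\chi^s$ ($\deg a_s<\deg\chi$) to $\min_s\{\rho(a_s)+s\beta\}$. Continuous MacLane chains. Let $\rho_0$ be a valuation with $\mathrm{KP}(\rho_0)\ne\emptyset$. A continuous MacLane chain of stable degree $m$ is an infinite sequence of valuations (values in a common ordered abelian group) $\rho_i=[\rho_{i-1};\chi_i,\beta_i]$, $i\ge1$, with $\chi_i\in\mathrm{KP}(\rho_{i-1})$, $\beta_i>\rho_{i-1}(\chi_i)$ finite, $\deg\chi_i=m$ and $\chi_{i+1}\nmid_{\rho_i}\chi_i$ for all $i\ge 1$. It is known that $\Gamma_{\rho_i}=\Gamma_{\rho_1}$ for all $i\ge1$; this group is the stable value group $\Gamma_\infty$, and $\beta_i\in\Gamma_\infty$. A polynomial $f$ is stable if $\rho_i(f)$ is constant for $i$ large. Let $m_\infty$ be the minimal degree of a non-stable polynomial ($\infty$ if there are none). The chain is essential if $m<m_\infty<\infty$. In this case $\mathrm{KP}_\infty((\rho_i)_{i\ge0})$,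 the set of MLV limit key polynomials of the chain, is the set of all monic non-stable polynomials of degree $m_\infty$. Invariants. For $b\ge0$, $\partial_b$ is the operator on $K[x]$ defined by $f(x+y)=\sum_{b\ge0}\partial_b(f)y^b$. For non-constant $f$, $\operatorname{mult}(f)$ is the least integer $b\ge1$ with $\partial_b(f)\ne0$. For $\phi\in\mathrm{KP}_\infty$ and $i\ge1$ let $\phi=\sum_s a_{s,i}\chi_i^s$ ($\deg a_{s,i}<m$) be the $\chi_i$-expansion, and let $t_i(\phi)$ be the maximal $s$ with $\rho_i(a_{s,i}\chi_i^s)=\rho_i(\phi)$. The integers $t_i(\phi)$ are positive and constant for $i$ large; the eventual value $t_\infty$ (numerical character) does not depend on the choice of $\phi$. Let $\nu$ be any valuation on $K[x]$ with $\nu>\rho_i$ for all $i$. For non-constant $f$ with $\nu(f)<\infty$ put $\epsilon(f)=\max_{b\ge1}\frac{\nu(f)-\nu(\partial_b(f))}{b}\in(\Gamma_\nu)_{\mathbb Q}$ and let $I(f)$ be the set of $b\ge1$ attaining this maximum. It is known that there is a positive integer $b_\infty$, independent of $\nu$, with $I(\chi_j)=\{b_\infty\}$ for all $j$ large enough. *)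

theory Defs
  imports
    "HOL-Library.Extended_Nat"
    "HOL-Library.Poly_Mapping"
    "HOL-Computational_Algebra.Polynomial"
    "HOL-Computational_Algebra.Group_Closure"
    "HOL-Algebra.Divisibility"
    "HOL-Algebra.QuotRing"
begin

section \<open>Value domains\<close>

text \<open>\<open>\<Lambda> \<union> {\<infinity>}\<close> for a totally ordered abelian group \<open>\<Lambda>\<close>.\<close>

datatype 'g topped = Fin (the_fin: 'g) | Infty

instantiation topped :: (linorder) linorder
begin

fun less_eq_topped :: "'a topped \<Rightarrow> 'a topped \<Rightarrow> bool" where
  "less_eq_topped _ Infty \<longleftrightarrow> True"
| "less_eq_topped Infty (Fin _) \<longleftrightarrow> False"
| "less_eq_topped (Fin a) (Fin b) \<longleftrightarrow> a \<le> b"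

definition less_topped :: "'a topped \<Rightarrow> 'a topped \<Rightarrow> bool" where
  "less_topped x y \<longleftrightarrow> x \<le> y \<and> \<not> y \<le> x"

instance
proof
  fix x y z :: "'a topped"
  show "x < y \<longleftrightarrow> x \<le> y \<and> \<not> y \<le> x" by (simp add: less_topped_def)
  show "x \<le> x" by (cases x) auto
  show "x \<le> y \<Longrightarrow> y \<le> z \<Longrightarrow> x \<le> z" by (cases x; cases y; cases z) auto
  show "x \<le> y \<Longrightarrow> y \<le> x \<Longrightarrow> x = y" by (cases x; cases y) auto
  show "x \<le> y \<or> y \<le> x" by (cases x; cases y) auto
qed

end

instantiation topped :: (comm_monoid_add) comm_monoid_add
begin

definition zero_topped :: "'a topped" where "zero_topped = Fin 0"

fun plus_topped :: "'a topped \<Rightarrow> 'a topped \<Rightarrow> 'a topped" where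
  "plus_topped (Fin a) (Fin b) = Fin (a + b)"
| "plus_topped Infty _ = Infty"
| "plus_topped _ Infty = Infty"

instance
proof
  fix x y z :: "'a topped"
  show "x + y + z = x + (y + z)" by (cases x; cases y; cases z) (auto simp: add.assoc)
  show "x + y = y + x" by (cases x; cases y) (auto simp: add.commute)
  show "0 + x = x" by (cases x) (auto simp: zero_topped_def)
qed

end

definition nmult :: "nat \<Rightarrow> 'g::comm_monoid_add \<Rightarrow> 'g" where
  "nmult n a = (\<Sum>i<n. a)"

lemma nmult_0 [simp]: "nmult 0 a = 0"
  and nmult_Suc [simp]: "nmult (Suc n) a = a + nmult n a"
  by (simp_all add: nmult_def add.commute)

lemma nmult_add_left: "nmult (m + n) a = nmult m a + nmult n a"
  by (induction m) (simp_all add: add.assoc)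

lemma nmult_nmult: "nmult m (nmult n a) = nmult (m * n) a"
  by (induction m) (simp_all add: nmult_add_left)

lemma nmult_mono: "a \<le> b \<Longrightarrow> nmult n a \<le> nmult n b" for a b :: "'g::linordered_ab_group_add"
  by (induction n) (auto intro: add_mono)

lemma nmult_strict_mono: "0 < n \<Longrightarrow> a < b \<Longrightarrow> nmult n a < nmult n b"
  for a b :: "'g::linordered_ab_group_add"
  by (cases n) (auto intro!: add_less_le_mono nmult_mono)

lemma nmult_le_iff: "0 < n \<Longrightarrow> nmult n a \<le> nmult n b \<longleftrightarrow> a \<le> b"
  for a b :: "'g::linordered_ab_group_add"
  by (meson nmult_mono nmult_strict_mono leD leI)

lemma nmult_eq_iff: "0 < n \<Longrightarrow> nmult n a = nmult n b \<longleftrightarrow> a = b"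
  for a b :: "'g::linordered_ab_group_add"
  by (auto simp: order_eq_iff nmult_le_iff)

text \<open>
  The ordered set underlying \<open>\<Lambda> \<otimes> \<rat>\<close>: fractions \<open>a / n\<close> with \<open>a \<in> \<Lambda>\<close> and \<open>n > 0\<close>.  Since \<open>\<Lambda>\<close> is
  torsion-free, \<open>a \<otimes> 1/m = b \<otimes> 1/n\<close> iff \<open>n a = m b\<close>, and the order of \<open>\<Lambda>\<close> extends uniquely.
\<close>

definition frac_rel :: "'g::linordered_ab_group_add \<times> nat \<Rightarrow> 'g \<times> nat \<Rightarrow> bool" where
  "frac_rel p q \<longleftrightarrow> 0 < snd p \<and> 0 < snd q \<and> nmult (snd q) (fst p) = nmult (snd p) (fst q)"

lemma frac_le_trans:
  fixes a b c :: "'g::linordered_ab_group_add"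
  assumes "0 < n" "nmult n a \<le> nmult m b" "nmult k b \<le> nmult n c"
  shows "nmult k a \<le> nmult m c"
proof -
  have "nmult n (nmult k a) = nmult k (nmult n a)" by (simp add: nmult_nmult mult.commute)
  also have "\<dots> \<le> nmult k (nmult m b)" using assms(2) by (rule nmult_mono)
  also have "\<dots> = nmult m (nmult k b)" by (simp add: nmult_nmult mult.commute)
  also have "\<dots> \<le> nmult m (nmult n c)" using assms(3) by (rule nmult_mono)
  also have "\<dots> = nmult n (nmult m c)" by (simp add: nmult_nmult mult.commute)
  finally show ?thesis using assms(1) by (simp add: nmult_le_iff)
qed

quotient_type (overloaded) 'g rational_hull = "'g::linordered_ab_group_add \<times> nat" / partial: frac_rel
proof (rule part_equivpI)
  show "\<exists>p::'g \<times> nat. frac_rel p p" by (rule exI[of _ "(0, 1)"]) (simp add: frac_rel_def)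
  show "symp (frac_rel :: 'g \<times> nat \<Rightarrow> _)" by (auto simp: symp_def frac_rel_def)
  show "transp (frac_rel :: 'g \<times> nat \<Rightarrow> _)"
    unfolding transp_def frac_rel_def by (metis frac_le_trans order_antisym order_refl)
qed

lift_definition qdiv :: "'g::linordered_ab_group_add \<Rightarrow> nat \<Rightarrow> 'g rational_hull"
  is "\<lambda>a n. (a, if n = 0 then 1 else n)"
  by (simp add: frac_rel_def)

instantiation rational_hull :: (linordered_ab_group_add) linorder
begin

lift_definition less_eq_rational_hull :: "'a rational_hull \<Rightarrow> 'a rational_hull \<Rightarrow> bool"
  is "\<lambda>p q. nmult (snd q) (fst p) \<le> nmult (snd p) (fst q)"
  unfolding frac_rel_def by (metis frac_le_trans order_refl)

definition less_rational_hull :: "'a rational_hull \<Rightarrow> 'a rational_hull \<Rightarrow> bool" where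
  "less_rational_hull x y \<longleftrightarrow> x \<le> y \<and> \<not> y \<le> x"

instance
proof
  fix x y z :: "'a rational_hull"
  show "x < y \<longleftrightarrow> x \<le> y \<and> \<not> y \<le> x" by (simp add: less_rational_hull_def)
  show "x \<le> x" by transfer simp
  show "x \<le> y \<Longrightarrow> y \<le> z \<Longrightarrow> x \<le> z" by transfer (metis frac_le_trans frac_rel_def)
  show "x \<le> y \<Longrightarrow> y \<le> x \<Longrightarrow> x = y" by transfer (simp add: frac_rel_def)
  show "x \<le> y \<or> y \<le> x" by transfer (rule linear)
qed

end

lemma qdiv_le_iff: "0 < m \<Longrightarrow> 0 < n \<Longrightarrow> qdiv a m \<le> qdiv b n \<longleftrightarrow> nmult n a \<le> nmult m b"
  by transfer simp

section \<open>Valuations and graded algebras\<close>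

text \<open>
  The last conjunct, together with the first two, says that the restriction to the constants is a
  valuation of the field \<open>K\<close>; non-constant polynomials may have value \<open>\<infinity>\<close>.
\<close>

definition valuation :: "('a::field poly \<Rightarrow> 'g::linordered_ab_group_add topped) \<Rightarrow> bool" where
  "valuation \<nu> \<longleftrightarrow>
     (\<forall>f g. \<nu> (f * g) = \<nu> f + \<nu> g) \<and>
     (\<forall>f g. min (\<nu> f) (\<nu> g) \<le> \<nu> (f + g)) \<and>
     (\<forall>a. \<nu> [:a:] = Infty \<longleftrightarrow> a = 0)"

definition value_group :: "('a::field poly \<Rightarrow> 'g::linordered_ab_group_add topped) \<Rightarrow> 'g set" where
  "value_group \<nu> = group_closure {\<alpha>. \<exists>f. \<nu> f = Fin \<alpha>}"

definition P_ge :: "('a::field poly \<Rightarrow> 'g::linordered_ab_group_add topped) \<Rightarrow> 'g \<Rightarrow> 'a poly set" where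
  "P_ge \<nu> \<alpha> = {g. Fin \<alpha> \<le> \<nu> g}"

definition P_gt :: "('a::field poly \<Rightarrow> 'g::linordered_ab_group_add topped) \<Rightarrow> 'g \<Rightarrow> 'a poly set" where
  "P_gt \<nu> \<alpha> = {g. Fin \<alpha> < \<nu> g}"

text \<open>
  The graded algebra is obtained as \<open>(\<Oplus>\<^sub>\<alpha> P\<^sub>\<alpha>) / (\<Oplus>\<^sub>\<alpha> P\<^sub>\<alpha>\<^sup>+)\<close>, where the direct sums over \<open>\<alpha> \<in> \<Gamma>\<^sub>\<nu>\<close>
  are sets of finitely supported functions and multiplication is convolution.
\<close>

definition sum_P_ge ::
  "('a::field poly \<Rightarrow> 'g::linordered_ab_group_add topped) \<Rightarrow> ('g \<Rightarrow>\<^sub>0 'a poly) ring" where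
  "sum_P_ge \<nu> =
     \<lparr>carrier = {F. Poly_Mapping.keys F \<subseteq> value_group \<nu> \<and> (\<forall>\<alpha>\<in>value_group \<nu>. Poly_Mapping.lookup F \<alpha> \<in> P_ge \<nu> \<alpha>)},
      mult = (*), one = 1, zero = 0, add = (+)\<rparr>"

definition sum_P_gt ::
  "('a::field poly \<Rightarrow> 'g::linordered_ab_group_add topped) \<Rightarrow> ('g \<Rightarrow>\<^sub>0 'a poly) set" where
  "sum_P_gt \<nu> = {F. Poly_Mapping.keys F \<subseteq> value_group \<nu> \<and> (\<forall>\<alpha>\<in>value_group \<nu>. Poly_Mapping.lookup F \<alpha> \<in> P_gt \<nu> \<alpha>)}"

definition graded_algebra ::
  "('a::field poly \<Rightarrow> 'g::linordered_ab_group_add topped) \<Rightarrow> ('g \<Rightarrow>\<^sub>0 'a poly) set ring" where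
  "graded_algebra \<nu> = sum_P_ge \<nu> Quot sum_P_gt \<nu>"

definition initial ::
  "('a::field poly \<Rightarrow> 'g::linordered_ab_group_add topped) \<Rightarrow> 'a poly \<Rightarrow> ('g \<Rightarrow>\<^sub>0 'a poly) set" where
  "initial \<nu> g =
     (case \<nu> g of
        Fin \<alpha> \<Rightarrow> sum_P_gt \<nu> +>\<^bsub>sum_P_ge \<nu>\<^esub> Poly_Mapping.single \<alpha> g
      | Infty \<Rightarrow> \<zero>\<^bsub>graded_algebra \<nu>\<^esub>)"

definition val_dvd ::
  "('a::field poly \<Rightarrow> 'g::linordered_ab_group_add topped) \<Rightarrow> 'a poly \<Rightarrow> 'a poly \<Rightarrow> bool" where
  "val_dvd \<nu> h g \<longleftrightarrow> initial \<nu> h divides\<^bsub>graded_algebra \<nu>\<^esub> initial \<nu> g"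

definition KP :: "('a::field poly \<Rightarrow> 'g::linordered_ab_group_add topped) \<Rightarrow> 'a poly set" where
  "KP \<nu> = {g. lead_coeff g = 1 \<and>
     primeideal (PIdl\<^bsub>graded_algebra \<nu>\<^esub> (initial \<nu> g)) (graded_algebra \<nu>) \<and>
     PIdl\<^bsub>graded_algebra \<nu>\<^esub> (initial \<nu> g) \<noteq> {\<zero>\<^bsub>graded_algebra \<nu>\<^esub>} \<and>
     (\<forall>f. f \<noteq> 0 \<and> degree f < degree g \<longrightarrow> \<not> val_dvd \<nu> g f)}"

section \<open>Ordinary augmentations and continuous MacLane chains\<close>

text \<open>
  The \<open>\<chi>\<close>-expansion \<open>f = \<Sum>\<^sub>s a\<^sub>s \<chi>\<^sup>s\<close> is encoded as the polynomial \<open>\<Sum>\<^sub>s a\<^sub>s Y\<^sup>s\<close> over \<open>K[x]\<close>.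
  It exists and is unique if \<open>\<chi>\<close> is non-constant.
\<close>

definition expansion :: "'a::field poly \<Rightarrow> 'a poly \<Rightarrow> 'a poly poly" where
  "expansion \<chi> f = (THE Q. (\<forall>s. degree (coeff Q s) < degree \<chi>) \<and> poly Q \<chi> = f)"

definition augmentation ::
  "('a::field poly \<Rightarrow> 'g::linordered_ab_group_add topped) \<Rightarrow> 'a poly \<Rightarrow> 'g \<Rightarrow>
   'a poly \<Rightarrow> 'g topped" where
  "augmentation \<rho> \<chi> \<beta> f =
     Min ((\<lambda>s. \<rho> (coeff (expansion \<chi> f) s) + Fin (nmult s \<beta>)) ` {..degree (expansion \<chi> f)})"

text \<open>Only \<open>\<chi> i\<close> and \<open>\<beta> i\<close> with \<open>i \<ge> 1\<close> matter; the entries at index \<open>0\<close> are irrelevant.\<close>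

definition continuous_MacLane_chain ::
  "(nat \<Rightarrow> 'a::field poly \<Rightarrow> 'g::linordered_ab_group_add topped) \<Rightarrow> (nat \<Rightarrow> 'a poly) \<Rightarrow>
   (nat \<Rightarrow> 'g) \<Rightarrow> nat \<Rightarrow> bool" where
  "continuous_MacLane_chain \<rho> \<chi> \<beta> m \<longleftrightarrow>
     (\<forall>i. valuation (\<rho> i)) \<and> KP (\<rho> 0) \<noteq> {} \<and>
     (\<forall>i\<ge>1. \<chi> i \<in> KP (\<rho> (i - 1)) \<and> \<rho> (i - 1) (\<chi> i) < Fin (\<beta> i) \<and>
            \<rho> i = augmentation (\<rho> (i - 1)) (\<chi> i) (\<beta> i) \<and>
            degree (\<chi> i) = m \<and> \<not> val_dvd (\<rho> i) (\<chi> (i + 1)) (\<chi> i))"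

definition stable_value_group ::
  "(nat \<Rightarrow> 'a::field poly \<Rightarrow> 'g::linordered_ab_group_add topped) \<Rightarrow> 'g set" where
  "stable_value_group \<rho> = value_group (\<rho> 1)"

definition stable ::
  "(nat \<Rightarrow> 'a::field poly \<Rightarrow> 'g::linordered_ab_group_add topped) \<Rightarrow> 'a poly \<Rightarrow> bool" where
  "stable \<rho> f \<longleftrightarrow> (\<exists>N. \<forall>i\<ge>N. \<rho> i f = \<rho> N f)"

definition m_inf ::
  "(nat \<Rightarrow> 'a::field poly \<Rightarrow> 'g::linordered_ab_group_add topped) \<Rightarrow> enat" where
  "m_inf \<rho> = (INF f\<in>{f. \<not> stable \<rho> f}. enat (degree f))"

definition essential_chain ::
  "(nat \<Rightarrow> 'a::field poly \<Rightarrow> 'g::linordered_ab_group_add topped) \<Rightarrow> (nat \<Rightarrow> 'a poly) \<Rightarrow>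
   (nat \<Rightarrow> 'g) \<Rightarrow> nat \<Rightarrow> bool" where
  "essential_chain \<rho> \<chi> \<beta> m \<longleftrightarrow>
     continuous_MacLane_chain \<rho> \<chi> \<beta> m \<and> enat m < m_inf \<rho> \<and> m_inf \<rho> < \<infinity>"

definition KP_inf ::
  "(nat \<Rightarrow> 'a::field poly \<Rightarrow> 'g::linordered_ab_group_add topped) \<Rightarrow> 'a poly set" where
  "KP_inf \<rho> = {f. lead_coeff f = 1 \<and> \<not> stable \<rho> f \<and> enat (degree f) = m_inf \<rho>}"

section \<open>Invariants\<close>

text \<open>
  \<open>f(x + y)\<close> is computed in \<open>K[x][y]\<close>: the coefficients of \<open>f\<close> are embedded into \<open>K[x]\<close> and the
  polynomial \<open>x + y\<close>, with constant coefficient \<open>x\<close> and linear coefficient \<open>1\<close>, is substituted.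
\<close>

definition hasse :: "nat \<Rightarrow> 'a::field poly \<Rightarrow> 'a poly" where
  "hasse b f = coeff (pcompose (map_poly (\<lambda>c. [:c:]) f) [:[:0, 1:], 1:]) b"

definition mult_order :: "'a::field poly \<Rightarrow> nat" where
  "mult_order f = (LEAST b. 1 \<le> b \<and> hasse b f \<noteq> 0)"

definition t_index ::
  "('a::field poly \<Rightarrow> 'g::linordered_ab_group_add topped) \<Rightarrow> 'a poly \<Rightarrow> 'a poly \<Rightarrow> nat" where
  "t_index \<rho> \<chi> \<phi> = Max {s. \<rho> (coeff (expansion \<chi> \<phi>) s * \<chi> ^ s) = \<rho> \<phi>}"

definition t_inf ::
  "(nat \<Rightarrow> 'a::field poly \<Rightarrow> 'g::linordered_ab_group_add topped) \<Rightarrow> (nat \<Rightarrow> 'a poly) \<Rightarrow> nat" where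
  "t_inf \<rho> \<chi> =
     (THE t. \<forall>\<phi>\<in>KP_inf \<rho>. \<forall>\<^sub>F i in sequentially. t_index (\<rho> i) (\<chi> i) \<phi> = t)"

text \<open>
  Indices \<open>b\<close> with \<open>\<nu>(\<partial>\<^sub>b f) = \<infinity>\<close> contribute \<open>-\<infinity>\<close> and never attain the maximum, hence they are left
  out; the set of remaining indices is finite, and contains \<open>deg f\<close> if \<open>f\<close> is non-constant.
\<close>

definition slope ::
  "('a::field poly \<Rightarrow> 'g::linordered_ab_group_add topped) \<Rightarrow> 'a poly \<Rightarrow> nat \<Rightarrow> 'g rational_hull" where
  "slope \<nu> f b = qdiv (the_fin (\<nu> f) - the_fin (\<nu> (hasse b f))) b"

definition epsilon ::
  "('a::field poly \<Rightarrow> 'g::linordered_ab_group_add topped) \<Rightarrow> 'a poly \<Rightarrow> 'g rational_hull" where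
  "epsilon \<nu> f = Max (slope \<nu> f ` {b. 1 \<le> b \<and> \<nu> (hasse b f) \<noteq> Infty})"

definition I_set ::
  "('a::field poly \<Rightarrow> 'g::linordered_ab_group_add topped) \<Rightarrow> 'a poly \<Rightarrow> nat set" where
  "I_set \<nu> f = {b. 1 \<le> b \<and> \<nu> (hasse b f) \<noteq> Infty \<and> slope \<nu> f b = epsilon \<nu> f}"

text \<open>
  The relation \<open>\<rho> i < \<nu>\<close> is the pointwise strict order on functions.  For an essential chain the
  quantification over \<open>\<nu>\<close> is not vacuous: for \<open>\<phi> \<in> KP_inf \<rho>\<close>, sending \<open>f\<close> to the stable value of
  \<open>f mod \<phi>\<close> (which is \<open>\<infinity>\<close> if \<open>\<phi>\<close> divides \<open>f\<close>) is such a valuation, with values in the stable value group.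
\<close>

definition b_inf ::
  "(nat \<Rightarrow> 'a::field poly \<Rightarrow> 'g::linordered_ab_group_add topped) \<Rightarrow> (nat \<Rightarrow> 'a poly) \<Rightarrow> nat" where
  "b_inf \<rho> \<chi> =
     (THE b. 0 < b \<and>
        (\<forall>\<nu> :: 'a poly \<Rightarrow> 'g topped. valuation \<nu> \<and> (\<forall>i. \<rho> i < \<nu>) \<longrightarrow>
           (\<forall>\<^sub>F j in sequentially. I_set \<nu> (\<chi> j) = {b})))"

end

theory Submission
  imports Defs
begin

text \<open>
  Write \<open>\<beta>\<close> for \<open>\<beta>\<^sub>j\<close> and \<open>\<chi>\<close> for \<open>\<chi>\<^sub>j\<close>, with \<open>j\<close> large, and study \<open>f(x + y)\<close> as a polynomial
  in \<open>y\<close> over \<open>K[x]\<close> (\<open>taylor f\<close>), whose coefficients are the \<open>\<partial>\<^sub>b f\<close>.  Give \<open>y\<close> a weight and put on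
  \<open>K[x][y]\<close> the corresponding Gauss valuation.  It is multiplicative, and moreover the largest
  exponent of \<open>y\<close> at which the minimum is attained is additive in products (\<open>last_min_mult\<close>).

  There is a constant \<open>c\<close> in \<open>\<Gamma>\<^sub>\<infinity>\<close> such that, for the weight \<open>c\<close>, the Gauss
  value of \<open>a(x + y)\<close> is the value of \<open>a\<close> whenever \<open>deg a < m\<close> (\<open>hasse_low_bound\<close>): an \<open>a\<close> of minimal degree
  for which this fails would, upon division of \<open>\<chi>\<^sub>1\<close> by \<open>a\<close>, make a derivative of \<open>\<chi>\<^sub>1\<close> have too small a
  value.

  Since \<open>\<chi>\<^bsub>j+1\<^esub> - \<chi>\<^sub>j\<close> has degree below \<open>m\<close> and value \<open>\<beta>\<^sub>j\<close>, the constant \<open>c\<close> forces, for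
  each \<open>b\<close>, that the value of \<open>\<partial>\<^sub>b \<chi>\<^sub>j\<close> either becomes constant or grows at least like \<open>\<beta>\<^sub>j - bc\<close>.  As the
  \<open>\<beta>\<^sub>j\<close> are unbounded, the slope of the least \<open>b \<ge> 1\<close> of the first kind eventually exceeds all the others
  (\<open>key_hasse_dominance\<close>).  This \<open>b\<close> is \<open>b\<^sub>\<infinity>\<close>, because the slopes only involve values that are
  the same for all valuations above the chain (\<open>I_set_key\<close>).  With \<open>\<delta>\<close> the limit value of
  \<open>\<partial>\<^sub>b \<chi>\<^sub>j\<close>, give \<open>y\<close> the weight \<open>(\<beta> - \<delta>)/b\<close>; then the minimum for \<open>\<chi>(x + y)\<close> is attained exactly at the
  exponents \<open>0\<close> and \<open>b\<close>, and for \<open>a(x + y)\<close> with \<open>deg a < m\<close> only at \<open>0\<close>.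

  For a limit key polynomial \<open>\<phi>\<close>, expanding \<open>\<phi> = \<Sum>\<^sub>s a\<^sub>s \<chi>\<^sup>s\<close> and letting \<open>t\<close> be the last index of a term of minimal
  value, additivity shows that the minimum for \<open>\<phi>(x + y)\<close> is \<open>\<rho>\<^sub>j(\<phi>)\<close> and is attained for the last time
  at the exponent \<open>t b\<close> (\<open>last_min_taylor\<close>); in particular \<open>\<partial>\<^bsub>tb\<^esub> \<phi> \<noteq> 0\<close>, so that \<open>mult(\<phi>) \<le> t b\<close>.  The
  polynomials \<open>\<partial>\<^sub>e \<phi>\<close> with \<open>e \<ge> 1\<close> have smaller degree than \<open>\<phi>\<close>, hence fixed values for large \<open>j\<close>.  Since
  the weight of \<open>y\<close> is unbounded, a nonzero \<open>\<partial>\<^sub>e \<phi>\<close> with \<open>1 \<le> e < t b\<close> would eventually give a value below the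
  minimum; so \<open>mult(\<phi>) = t b\<close> for all large \<open>j\<close> (\<open>t_index_times_b_eq_mult_order\<close>).

  In the formal proof the fractional weight is avoided by multiplying all values by \<open>b\<close>.
\<close>

section \<open>Values and valuations\<close>

instance topped :: (linordered_ab_group_add) ordered_comm_monoid_add
proof
  fix x y z :: "'a topped"
  show "x \<le> y \<Longrightarrow> z + x \<le> z + y" by (cases x; cases y; cases z) auto
qed

lemma Fin_less_iff [simp]: "Fin a < Fin b \<longleftrightarrow> a < b"
  for a b :: "'g::linorder"
  by (auto simp: less_topped_def)

lemma Fin_less_Infty [simp]: "Fin a < Infty"
  and not_Infty_less [simp]: "\<not> Infty < x"
  for a :: "'g::linorder" and x :: "'g topped"
  by (auto simp: less_topped_def)

lemma Infty_le_iff [simp]: "Infty \<le> x \<longleftrightarrow> x = Infty"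
  for x :: "'g::linorder topped"
  by (cases x) auto

lemma plus_Infty [simp]: "x + Infty = Infty"
  for x :: "'g::comm_monoid_add topped"
  by (cases x) auto

lemma plus_eq_Infty_iff [simp]: "x + y = Infty \<longleftrightarrow> x = Infty \<or> y = Infty"
  for x y :: "'g::comm_monoid_add topped"
  by (cases x; cases y) auto

lemma topped_add_less_mono: "x < y \<Longrightarrow> z \<noteq> Infty \<Longrightarrow> x + z < y + z"
  for x y z :: "'g::linordered_ab_group_add topped"
  by (cases x; cases y; cases z) auto

lemma topped_add_le_less_mono:
  "Fin a \<le> x \<Longrightarrow> Fin b < y \<Longrightarrow> Fin (a + b) < x + y"
  for x y :: "'g::linordered_ab_group_add topped"
  by (cases x; cases y) (auto intro: add_le_less_mono)

lemma topped_add_mono: "Fin a \<le> x \<Longrightarrow> Fin b \<le> y \<Longrightarrow> Fin (a + b) \<le> x + y"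
  for x y :: "'g::linordered_ab_group_add topped"
  by (cases x; cases y) (auto intro: add_mono)

lemma Fin_le_add_Fin_iff: "Fin w \<le> x + Fin z \<longleftrightarrow> Fin (w - z) \<le> x"
  and Fin_less_add_Fin_iff: "Fin w < x + Fin z \<longleftrightarrow> Fin (w - z) < x"
  for w z :: "'g::linordered_ab_group_add"
  by (cases x; simp add: algebra_simps)+

lemma nmult_Fin: "nmult n (Fin a) = Fin (nmult n a)"
  by (induction n) (auto simp: zero_topped_def)

lemma nmult_add_right: "nmult n (a + b) = nmult n a + nmult n b"
  by (induction n) (auto simp: algebra_simps)

lemma nmult_diff_right: "nmult n (a - b) = nmult n a - nmult n b"
  for a b :: "'g::ab_group_add"
  by (induction n) (auto simp: algebra_simps)

lemma nmult_diff_left: "k \<le> n \<Longrightarrow> nmult (n - k) a = nmult n a - nmult k a"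
  for a :: "'g::ab_group_add"
  using nmult_add_left[of "n - k" k a] by (simp add: algebra_simps)

lemma nmult_Infty: "0 < n \<Longrightarrow> nmult n Infty = Infty"
  by (cases n) auto

lemma nmult_topped_eq_Infty_iff: "0 < n \<Longrightarrow> nmult n x = Infty \<longleftrightarrow> x = Infty"
  for x :: "'g::linordered_ab_group_add topped"
  by (cases x) (auto simp: nmult_Fin nmult_Infty)

lemma nmult_topped_mono: "0 < n \<Longrightarrow> x \<le> y \<Longrightarrow> nmult n x \<le> nmult n y"
  for x y :: "'g::linordered_ab_group_add topped"
  by (cases x; cases y) (auto simp: nmult_Fin nmult_Infty nmult_mono)

lemma nmult_nonneg: "0 \<le> a \<Longrightarrow> 0 \<le> nmult n a"
  for a :: "'g::linordered_ab_group_add"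
  by (induction n) auto

lemma nmult_ge_self: "0 \<le> a \<Longrightarrow> 0 < n \<Longrightarrow> a \<le> nmult n a"
  for a :: "'g::linordered_ab_group_add"
  by (cases n) (auto simp: nmult_nonneg)

context
  fixes \<nu> :: "'a::field poly \<Rightarrow> 'g::linordered_ab_group_add topped"
  assumes \<nu>: "valuation \<nu>"
begin

lemma val_mult: "\<nu> (f * g) = \<nu> f + \<nu> g"
  and val_add: "min (\<nu> f) (\<nu> g) \<le> \<nu> (f + g)"
  and val_const: "\<nu> [:a:] = Infty \<longleftrightarrow> a = 0"
  using \<nu> by (auto simp: valuation_def)

lemma val_zero: "\<nu> 0 = Infty"
  using val_const[of 0] by simp

lemma val_one: "\<nu> 1 = Fin 0"
proof -
  have "\<nu> 1 = \<nu> 1 + \<nu> 1" using val_mult[of 1 1] by simp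
  moreover have "\<nu> 1 \<noteq> Infty" using val_const[of 1] by (simp add: one_pCons)
  ultimately show ?thesis by (cases "\<nu> 1") auto
qed

lemma val_minus: "\<nu> (- f) = \<nu> f"
proof -
  have "\<nu> (- 1) + \<nu> (- 1) = Fin 0" using val_mult[of "-1" "-1"] by (simp add: val_one)
  then have "\<nu> (- 1) = Fin 0" by (cases "\<nu> (- 1)") (auto simp: double_zero)
  then show ?thesis using val_mult[of "-1" f] by (cases "\<nu> f") auto
qed

lemma val_diff: "min (\<nu> f) (\<nu> g) \<le> \<nu> (f - g)"
  using val_add[of f "- g"] by (simp add: val_minus)

lemma val_add_ge: "w \<le> \<nu> f \<Longrightarrow> w \<le> \<nu> g \<Longrightarrow> w \<le> \<nu> (f + g)"
  and val_add_gt: "w < \<nu> f \<Longrightarrow> w < \<nu> g \<Longrightarrow> w < \<nu> (f + g)"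
  and val_diff_ge: "w \<le> \<nu> f \<Longrightarrow> w \<le> \<nu> g \<Longrightarrow> w \<le> \<nu> (f - g)"
  and val_diff_gt: "w < \<nu> f \<Longrightarrow> w < \<nu> g \<Longrightarrow> w < \<nu> (f - g)"
  using val_add[of f g] val_diff[of f g] by (auto simp: min_def split: if_splits)

lemma val_add_eq:
  assumes "\<nu> f < \<nu> g" shows "\<nu> (f + g) = \<nu> f"
proof (rule antisym)
  show "\<nu> f \<le> \<nu> (f + g)" using assms by (intro val_add_ge) auto
  show "\<nu> (f + g) \<le> \<nu> f"
    using val_diff_gt[of "\<nu> f" "f + g" g] assms by force
qed

lemma val_sum_ge: "(\<And>i. i \<in> A \<Longrightarrow> w \<le> \<nu> (f i)) \<Longrightarrow> w \<le> \<nu> (sum f A)"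
  by (induction A rule: infinite_finite_induct) (auto simp: val_zero intro: val_add_ge)

lemma val_sum_gt:
  assumes "w \<noteq> Infty" "\<And>i. i \<in> A \<Longrightarrow> w < \<nu> (f i)"
  shows "w < \<nu> (sum f A)"
proof -
  have "w < Infty" using assms(1) by (cases w) auto
  then show ?thesis using assms(2)
    by (induction A rule: infinite_finite_induct) (auto simp: val_zero intro: val_add_gt)
qed

lemma val_power: "\<nu> f = Fin a \<Longrightarrow> \<nu> (f ^ n) = Fin (nmult n a)"
  by (induction n) (auto simp: val_one val_mult)

lemma valuation_scale:
  assumes "0 < n" shows "valuation (\<lambda>f. nmult n (\<nu> f))"
  unfolding valuation_def
proof (intro conjI allI)
  fix f g
  show "min (nmult n (\<nu> f)) (nmult n (\<nu> g)) \<le> nmult n (\<nu> (f + g))"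
  proof (cases "\<nu> f \<le> \<nu> g")
    case True
    then have "\<nu> f \<le> \<nu> (f + g)" by (intro val_add_ge) auto
    then show ?thesis using nmult_topped_mono[OF assms] by (meson min.coboundedI1)
  next
    case False
    then have "\<nu> g \<le> \<nu> (f + g)" by (intro val_add_ge) auto
    then show ?thesis using nmult_topped_mono[OF assms] by (meson min.coboundedI2)
  qed
qed (simp_all only: val_mult nmult_add_right nmult_topped_eq_Infty_iff[OF assms] val_const)

end

text \<open>
  A nonzero constant and its inverse have opposite values: if one increased, the other would decrease.
\<close>

lemma val_const_le_imp_eq:
  assumes \<mu>: "valuation \<mu>" and \<nu>: "valuation \<nu>" and le: "\<And>f. \<mu> f \<le> \<nu> f" and deg: "degree a = 0"
  shows "\<nu> a = \<mu> a"
proof (cases "a = 0")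
  case True
  then show ?thesis by (simp add: val_zero[OF \<mu>] val_zero[OF \<nu>])
next
  case False
  then obtain c where c: "a = [:c:]" "c \<noteq> 0" using deg by (metis degree_eq_zeroE pCons_0_0)
  define b where "b = [:inverse c:]"
  have ab: "a * b = 1" using c by (simp add: b_def one_pCons)
  have "\<nu> a + \<nu> b = Fin 0" using val_mult[OF \<nu>, of a b] ab val_one[OF \<nu>] by simp
  moreover have "\<mu> a + \<mu> b = Fin 0" using val_mult[OF \<mu>, of a b] ab val_one[OF \<mu>] by simp
  ultimately have ab: "\<nu> a + \<nu> b = \<mu> a + \<mu> b" "\<mu> a + \<mu> b \<noteq> Infty" by auto
  show ?thesis
  proof (rule antisym[OF _ le], rule leI, rule notI)
    assume "\<mu> a < \<nu> a"
    then have "\<mu> a + \<mu> b < \<nu> a + \<mu> b" using ab(2) by (intro topped_add_less_mono) auto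
    also have "\<dots> \<le> \<nu> a + \<nu> b" by (intro add_left_mono le)
    finally show False using ab(1) by simp
  qed
qed

section \<open>The graded algebra and divisibility of initial forms\<close>

text \<open>
  Key polynomials enter only through non-divisibility statements, so it suffices to produce
  divisibilities in the graded algebra.  This needs that \<open>\<Oplus>\<^sub>\<alpha> P\<^sub>\<alpha>\<close> is a commutative ring with ideal
  \<open>\<Oplus>\<^sub>\<alpha> P\<^sub>\<alpha>\<^sup>+\<close>, so that products of cosets can be computed on representatives.
\<close>

context
  fixes \<nu> :: "'a::field poly \<Rightarrow> 'g::linordered_ab_group_add topped"
  assumes \<nu>: "valuation \<nu>"
begin

lemma value_group_zero: "0 \<in> value_group \<nu>"
  and value_group_diff: "a \<in> value_group \<nu> \<Longrightarrow> b \<in> value_group \<nu> \<Longrightarrow> a - b \<in> value_group \<nu>"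
  and value_group_add: "a \<in> value_group \<nu> \<Longrightarrow> b \<in> value_group \<nu> \<Longrightarrow> a + b \<in> value_group \<nu>"
  and value_group_base: "\<nu> f = Fin a \<Longrightarrow> a \<in> value_group \<nu>"
  by (auto simp: value_group_def intro: group_closure.diff group_closure_add group_closure.base)

lemma value_group_nmult: "a \<in> value_group \<nu> \<Longrightarrow> nmult n a \<in> value_group \<nu>"
  by (induction n) (auto simp: value_group_zero value_group_add)

lemma sum_P_ge_iff:
  "F \<in> carrier (sum_P_ge \<nu>) \<longleftrightarrow>
    (\<forall>\<alpha>. Poly_Mapping.lookup F \<alpha> \<noteq> 0 \<longrightarrow> \<alpha> \<in> value_group \<nu> \<and> Fin \<alpha> \<le> \<nu> (Poly_Mapping.lookup F \<alpha>))"
  using val_zero[OF \<nu>] unfolding sum_P_ge_def P_ge_def subset_iff Poly_Mapping.in_keys_iff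
  by (auto, metis Fin_less_Infty less_imp_le)

lemma sum_P_gt_iff:
  "F \<in> sum_P_gt \<nu> \<longleftrightarrow>
    (\<forall>\<alpha>. Poly_Mapping.lookup F \<alpha> \<noteq> 0 \<longrightarrow> \<alpha> \<in> value_group \<nu> \<and> Fin \<alpha> < \<nu> (Poly_Mapping.lookup F \<alpha>))"
  using val_zero[OF \<nu>] unfolding sum_P_gt_def P_gt_def subset_iff Poly_Mapping.in_keys_iff
  by (auto, metis Fin_less_Infty)

lemma sum_P_gt_subset: "sum_P_gt \<nu> \<subseteq> carrier (sum_P_ge \<nu>)"
  by (simp add: subset_iff sum_P_ge_iff sum_P_gt_iff less_imp_le)

lemma sum_P_ge_add: "F \<in> carrier (sum_P_ge \<nu>) \<Longrightarrow> G \<in> carrier (sum_P_ge \<nu>) \<Longrightarrow> F + G \<in> carrier (sum_P_ge \<nu>)"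
  unfolding sum_P_ge_iff lookup_add
  by (metis add.right_neutral add_0 val_add_ge[OF \<nu>])

lemma sum_P_gt_add: "F \<in> sum_P_gt \<nu> \<Longrightarrow> G \<in> sum_P_gt \<nu> \<Longrightarrow> F + G \<in> sum_P_gt \<nu>"
  unfolding sum_P_gt_iff lookup_add
  by (metis add.right_neutral add_0 val_add_gt[OF \<nu>])

lemma sum_P_ge_minus: "F \<in> carrier (sum_P_ge \<nu>) \<Longrightarrow> - F \<in> carrier (sum_P_ge \<nu>)"
  by (simp add: sum_P_ge_iff val_minus[OF \<nu>])

lemma sum_P_gt_minus: "F \<in> sum_P_gt \<nu> \<Longrightarrow> - F \<in> sum_P_gt \<nu>"
  by (simp add: sum_P_gt_iff val_minus[OF \<nu>])

lemma sum_P_ge_zero: "0 \<in> carrier (sum_P_ge \<nu>)" and sum_P_gt_zero: "0 \<in> sum_P_gt \<nu>"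
  by (simp_all add: sum_P_ge_iff sum_P_gt_iff)

lemma single_in_sum_P_ge:
  "a \<in> value_group \<nu> \<Longrightarrow> Fin a \<le> \<nu> f \<Longrightarrow> Poly_Mapping.single a f \<in> carrier (sum_P_ge \<nu>)"
  by (simp add: sum_P_ge_iff lookup_single when_def)

lemma single_in_sum_P_gt:
  "a \<in> value_group \<nu> \<Longrightarrow> Fin a < \<nu> f \<Longrightarrow> Poly_Mapping.single a f \<in> sum_P_gt \<nu>"
  by (simp add: sum_P_gt_iff lookup_single when_def)

lemma mult_as_sum_of_singles:
  fixes F G :: "'g \<Rightarrow>\<^sub>0 'a poly"
  shows "F * G = (\<Sum>a\<in>Poly_Mapping.keys F. \<Sum>b\<in>Poly_Mapping.keys G.
    Poly_Mapping.single (a + b) (Poly_Mapping.lookup F a * Poly_Mapping.lookup G b))"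
proof -
  have decomp: "H = (\<Sum>a\<in>Poly_Mapping.keys H. Poly_Mapping.single a (Poly_Mapping.lookup H a))" for H :: "'g \<Rightarrow>\<^sub>0 'a poly"
    by (rule poly_mapping_eqI) (auto simp: lookup_sum lookup_single when_def Poly_Mapping.in_keys_iff)
  show ?thesis
    by (rule trans[OF arg_cong2[where f = "\<lambda>F G :: 'g \<Rightarrow>\<^sub>0 'a poly. F * G", OF decomp decomp]]) (simp add: sum_product mult_single)
qed

lemma sum_P_ge_mult:
  assumes F: "F \<in> carrier (sum_P_ge \<nu>)" and G: "G \<in> carrier (sum_P_ge \<nu>)"
  shows "F * G \<in> carrier (sum_P_ge \<nu>)"
proof -
  have sum: "sum f A \<in> carrier (sum_P_ge \<nu>)" if "\<And>x. x \<in> A \<Longrightarrow> f x \<in> carrier (sum_P_ge \<nu>)"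
    for f and A :: "'g set"
    using that by (induction A rule: infinite_finite_induct) (auto simp: sum_P_ge_zero sum_P_ge_add)
  show ?thesis
    unfolding mult_as_sum_of_singles using F G
    by (intro sum single_in_sum_P_ge)
       (auto simp: sum_P_ge_iff Poly_Mapping.in_keys_iff val_mult[OF \<nu>] intro!: value_group_add topped_add_mono)
qed

lemma sum_P_gt_mult:
  assumes F: "F \<in> carrier (sum_P_ge \<nu>)" and G: "G \<in> sum_P_gt \<nu>"
  shows "F * G \<in> sum_P_gt \<nu>"
proof -
  have sum: "sum f A \<in> sum_P_gt \<nu>" if "\<And>x. x \<in> A \<Longrightarrow> f x \<in> sum_P_gt \<nu>"
    for f and A :: "'g set"
    using that by (induction A rule: infinite_finite_induct) (auto simp: sum_P_gt_zero sum_P_gt_add)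
  show ?thesis
    unfolding mult_as_sum_of_singles using F G
    by (intro sum single_in_sum_P_gt)
       (auto simp: sum_P_ge_iff sum_P_gt_iff Poly_Mapping.in_keys_iff val_mult[OF \<nu>]
         intro!: value_group_add topped_add_le_less_mono)
qed

lemma sum_P_ge_simps:
  "mult (sum_P_ge \<nu>) = (*)" "add (sum_P_ge \<nu>) = (+)" "one (sum_P_ge \<nu>) = 1" "zero (sum_P_ge \<nu>) = 0"
  by (simp_all add: sum_P_ge_def)

lemma cring_sum_P_ge: "cring (sum_P_ge \<nu>)"
proof (rule cringI)
  show "abelian_group (sum_P_ge \<nu>)"
  proof (rule abelian_groupI)
    fix F assume "F \<in> carrier (sum_P_ge \<nu>)"
    then show "\<exists>G\<in>carrier (sum_P_ge \<nu>). G \<oplus>\<^bsub>sum_P_ge \<nu>\<^esub> F = \<zero>\<^bsub>sum_P_ge \<nu>\<^esub>"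
      by (intro bexI[of _ "- F"]) (auto simp: sum_P_ge_simps sum_P_ge_minus)
  qed (auto simp: sum_P_ge_simps sum_P_ge_add sum_P_ge_zero algebra_simps)
  have "1 \<in> carrier (sum_P_ge \<nu>)"
    unfolding single_one[symmetric] by (intro single_in_sum_P_ge) (auto simp: value_group_zero val_one[OF \<nu>])
  then show "comm_monoid (sum_P_ge \<nu>)"
    by (intro comm_monoidI) (auto simp: sum_P_ge_simps sum_P_ge_mult algebra_simps)
qed (auto simp: sum_P_ge_simps algebra_simps)

lemma ideal_sum_P_gt: "ideal (sum_P_gt \<nu>) (sum_P_ge \<nu>)"
proof -
  interpret cring "sum_P_ge \<nu>" by (rule cring_sum_P_ge)
  have neg: "\<ominus>\<^bsub>sum_P_ge \<nu>\<^esub> F = - F" if "F \<in> carrier (sum_P_ge \<nu>)" for F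
    using that by (intro minus_equality) (auto simp: sum_P_ge_simps sum_P_ge_minus)
  show ?thesis
  proof (rule idealI[OF ring_axioms])
    show "subgroup (sum_P_gt \<nu>) (add_monoid (sum_P_ge \<nu>))"
    proof (rule subgroup.intro)
      fix F assume F: "F \<in> sum_P_gt \<nu>"
      then have "inv\<^bsub>add_monoid (sum_P_ge \<nu>)\<^esub> F = - F"
        using neg[of F] sum_P_gt_subset by (auto simp: a_inv_def)
      then show "inv\<^bsub>add_monoid (sum_P_ge \<nu>)\<^esub> F \<in> sum_P_gt \<nu>" using sum_P_gt_minus[OF F] by simp
    qed (use sum_P_gt_subset in \<open>auto simp: sum_P_ge_simps sum_P_gt_add sum_P_gt_zero\<close>)
  next
    fix F G assume "F \<in> sum_P_gt \<nu>" "G \<in> carrier (sum_P_ge \<nu>)"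
    then have "G * F \<in> sum_P_gt \<nu>" by (intro sum_P_gt_mult)
    then show "G \<otimes>\<^bsub>sum_P_ge \<nu>\<^esub> F \<in> sum_P_gt \<nu>" "F \<otimes>\<^bsub>sum_P_ge \<nu>\<^esub> G \<in> sum_P_gt \<nu>"
      by (simp_all add: sum_P_ge_simps mult.commute)
  qed
qed

lemma initial_in_carrier: "initial \<nu> f \<in> carrier (graded_algebra \<nu>)"
proof -
  interpret ideal "sum_P_gt \<nu>" "sum_P_ge \<nu>" by (rule ideal_sum_P_gt)
  interpret G: ring "graded_algebra \<nu>" unfolding graded_algebra_def by (rule quotient_is_ring)
  show ?thesis
  proof (cases "\<nu> f")
    case (Fin a)
    then have "Poly_Mapping.single a f \<in> carrier (sum_P_ge \<nu>)"
      by (intro single_in_sum_P_ge value_group_base[OF Fin]) auto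
    then show ?thesis
      by (simp add: initial_def Fin graded_algebra_def FactRing_def a_rcosetsI a_subset)
  next
    case Infty
    then show ?thesis by (simp add: initial_def)
  qed
qed

text \<open>
  An element of infinite value has initial form zero, and zero is divisible by everything.
\<close>

lemma val_dvd_Infty:
  assumes "\<nu> f = Infty" shows "val_dvd \<nu> h f"
proof -
  interpret ideal "sum_P_gt \<nu>" "sum_P_ge \<nu>" by (rule ideal_sum_P_gt)
  interpret G: ring "graded_algebra \<nu>" unfolding graded_algebra_def by (rule quotient_is_ring)
  have "initial \<nu> f = initial \<nu> h \<otimes>\<^bsub>graded_algebra \<nu>\<^esub> \<zero>\<^bsub>graded_algebra \<nu>\<^esub>"
    using initial_in_carrier[of h] assms by (simp add: initial_def)
  then show ?thesis unfolding val_dvd_def factor_def by blast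
qed

text \<open>
  If \<open>q h\<close> approximates \<open>f\<close> to higher order, then \<open>f\<close> and \<open>q h\<close> have the same initial form, and that of
  \<open>q h\<close> is the product of the two initial forms.
\<close>

lemma val_dvdI:
  assumes lt: "\<nu> f < \<nu> (f - q * h)"
  shows "val_dvd \<nu> h f"
proof -
  interpret ideal "sum_P_gt \<nu>" "sum_P_ge \<nu>" by (rule ideal_sum_P_gt)
  have "\<nu> (q * h) = \<nu> f"
    using val_add_eq[OF \<nu>, of f "q * h - f"] lt val_minus[OF \<nu>, of "f - q * h"] by simp
  moreover have "\<nu> f \<noteq> Infty" using lt by auto
  ultimately obtain a b where ab: "\<nu> q = Fin a" "\<nu> h = Fin b" "\<nu> f = Fin (b + a)"
    using val_mult[OF \<nu>, of q h] by (cases "\<nu> q"; cases "\<nu> h") (auto simp: add.commute)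
  note group = ab(1,2,3)[THEN value_group_base]
  have carr: "Poly_Mapping.single a q \<in> carrier (sum_P_ge \<nu>)" "Poly_Mapping.single b h \<in> carrier (sum_P_ge \<nu>)"
    "Poly_Mapping.single (b + a) f \<in> carrier (sum_P_ge \<nu>)"
    "Poly_Mapping.single (b + a) (h * q) \<in> carrier (sum_P_ge \<nu>)"
    using ab \<open>\<nu> (q * h) = \<nu> f\<close> by (auto intro!: single_in_sum_P_ge group simp: mult.commute)
  have "initial \<nu> h \<otimes>\<^bsub>graded_algebra \<nu>\<^esub> initial \<nu> q
      = sum_P_gt \<nu> +>\<^bsub>sum_P_ge \<nu>\<^esub> Poly_Mapping.single (b + a) (h * q)"
    using carr by (simp add: initial_def ab graded_algebra_def FactRing_def rcoset_mult_add sum_P_ge_simps mult_single)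
  also have "\<dots> = sum_P_gt \<nu> +>\<^bsub>sum_P_ge \<nu>\<^esub> Poly_Mapping.single (b + a) f"
  proof (rule a_repr_independence')
    have "Poly_Mapping.single (b + a) (f - q * h) \<in> sum_P_gt \<nu>"
      using lt ab by (intro single_in_sum_P_gt group) auto
    moreover have "Poly_Mapping.single (b + a) f
        = Poly_Mapping.single (b + a) (f - q * h) + Poly_Mapping.single (b + a) (h * q)"
      by (simp add: single_add[symmetric] mult.commute)
    ultimately show "Poly_Mapping.single (b + a) f
        \<in> sum_P_gt \<nu> +>\<^bsub>sum_P_ge \<nu>\<^esub> Poly_Mapping.single (b + a) (h * q)"
      unfolding a_r_coset_def' sum_P_ge_simps by blast
  qed (use carr in auto)
  finally have "initial \<nu> f = initial \<nu> h \<otimes>\<^bsub>graded_algebra \<nu>\<^esub> initial \<nu> q"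
    by (simp add: initial_def ab)
  then show ?thesis unfolding val_dvd_def factor_def using initial_in_carrier by blast
qed

end

section \<open>Key polynomials, expansions and augmentations\<close>

text \<open>
  Otherwise \<open>- q \<chi>\<close> would approximate \<open>r\<close> to higher order, and \<open>\<chi>\<close> would divide the initial form of a
  polynomial of smaller degree.
\<close>

lemma key_poly_remainder:
  assumes "valuation \<rho>" "\<chi> \<in> KP \<rho>" "degree r < degree \<chi>"
  shows "\<rho> (q * \<chi> + r) \<le> \<rho> r"
proof (cases "r = 0")
  case True
  then show ?thesis by (simp add: val_zero[OF assms(1)])
next
  case False
  then have "\<not> val_dvd \<rho> \<chi> r" using assms(2,3) by (simp add: KP_def)
  then show ?thesis
    using val_dvdI[OF assms(1), of r "- q" \<chi>] by (auto simp: add.commute not_less[symmetric])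
qed

lemma key_poly_finite:
  assumes "valuation \<rho>" "\<chi> \<in> KP \<rho>" "degree r < degree \<chi>" "r \<noteq> 0"
  shows "\<rho> r \<noteq> Infty"
  using assms val_dvd_Infty[OF assms(1), of r \<chi>] by (auto simp: KP_def)

lemma degree_mod_lt: "0 < degree \<chi> \<Longrightarrow> degree (f mod \<chi>) < degree \<chi>"
  for f \<chi> :: "'a::field poly"
  using degree_mod_less[of \<chi> f] by (cases "\<chi> = 0") auto

lemma reduced_zero_unique:
  fixes \<chi> :: "'a::field poly"
  assumes "\<forall>s. degree (coeff Q s) < degree \<chi>" "poly Q \<chi> = 0"
  shows "Q = 0"
  using assms
proof (induction Q)
  case (pCons a Q)
  have a: "degree a < degree \<chi>" using pCons.prems(1)[rule_format, of 0] by simp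
  have "\<chi> dvd a" using pCons.prems(2) by (metis dvd_0_right dvd_add_left_iff dvd_triv_left poly_pCons)
  then have "a = 0" using a by (meson dvd_imp_degree_le leD)
  moreover have "poly Q \<chi> = 0" using pCons.prems(2) \<open>a = 0\<close> a by auto
  then have "Q = 0" using pCons.prems(1) by (intro pCons.IH) (auto, metis coeff_pCons_Suc)
  ultimately show ?case by simp
qed auto

lemma expansion_exists:
  fixes \<chi> f :: "'a::field poly"
  assumes "0 < degree \<chi>"
  shows "\<exists>Q. (\<forall>s. degree (coeff Q s) < degree \<chi>) \<and> poly Q \<chi> = f"
proof (induction "degree f" arbitrary: f rule: less_induct)
  case less
  show ?case
  proof (cases "degree f < degree \<chi>")
    case True
    then show ?thesis using assms
      by (intro exI[of _ "[:f:]"]) (auto simp: coeff_pCons split: nat.split)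
  next
    case False
    then have "degree (f div \<chi>) < degree f" using assms by (intro degree_div_less) auto
    from less[OF this] obtain Q where "\<forall>s. degree (coeff Q s) < degree \<chi>" "poly Q \<chi> = f div \<chi>" by auto
    moreover have "degree (f mod \<chi>) < degree \<chi>" by (rule degree_mod_lt[OF assms])
    ultimately show ?thesis
      by (intro exI[of _ "pCons (f mod \<chi>) Q"])
         (auto simp: coeff_pCons mult.commute split: nat.split)
  qed
qed

lemma expansion_eqI:
  assumes "\<forall>s. degree (coeff Q s) < degree \<chi>" "poly Q \<chi> = f"
  shows "expansion \<chi> f = Q"
  unfolding expansion_def
proof (rule the_equality)
  fix R assume R: "(\<forall>s. degree (coeff R s) < degree \<chi>) \<and> poly R \<chi> = f"
  then have "R - Q = 0" using assms
    by (intro reduced_zero_unique[of _ \<chi>]) (auto intro: degree_diff_less)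
  then show "R = Q" by simp
qed (use assms in auto)

lemma expansion_props:
  assumes "0 < degree \<chi>"
  shows expansion_degree: "degree (coeff (expansion \<chi> f) s) < degree \<chi>"
    and poly_expansion: "poly (expansion \<chi> f) \<chi> = f"
  using expansion_exists[OF assms, of f] expansion_eqI by metis+

lemma expansion_add:
  assumes "0 < degree \<chi>"
  shows "expansion \<chi> (f + g) = expansion \<chi> f + expansion \<chi> g"
  by (rule expansion_eqI) (auto simp: expansion_props[OF assms] intro!: degree_add_less)

text \<open>
  Together with the ultrametric inequality this says that \<open>\<rho>\<close> is the minimum over the terms of the
  \<open>\<chi>\<close>-expansion, that is, \<open>\<rho> = [\<rho>; \<chi>, \<rho>(\<chi>)]\<close>.
\<close>

lemma key_poly_expansion_le:
  assumes \<rho>: "valuation \<rho>" and \<chi>: "\<chi> \<in> KP \<rho>" and Q: "\<forall>s. degree (coeff Q s) < degree \<chi>"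
  shows "\<rho> (poly Q \<chi>) \<le> \<rho> (coeff Q s * \<chi> ^ s)"
  using Q
proof (induction Q arbitrary: s)
  case 0
  then show ?case by (simp add: val_zero[OF \<rho>])
next
  case (pCons a Q)
  have a: "\<rho> (poly (pCons a Q) \<chi>) \<le> \<rho> a"
    using key_poly_remainder[OF \<rho> \<chi>, of a "poly Q \<chi>"] pCons.prems[rule_format, of 0]
    by (simp add: add.commute mult.commute)
  show ?case
  proof (cases s)
    case 0
    then show ?thesis using a by simp
  next
    case (Suc n)
    have "\<rho> (poly (pCons a Q) \<chi>) \<le> \<rho> (\<chi> * poly Q \<chi>)"
      using val_diff_ge[OF \<rho> order_refl a] by simp
    also have "\<dots> \<le> \<rho> \<chi> + \<rho> (coeff Q n * \<chi> ^ n)"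
      unfolding val_mult[OF \<rho>, of \<chi>] using pCons.prems
      by (intro add_left_mono pCons.IH) (auto, metis coeff_pCons_Suc)
    also have "\<dots> = \<rho> (coeff (pCons a Q) s * \<chi> ^ s)"
      using Suc by (simp add: val_mult[OF \<rho>] algebra_simps)
    finally show ?thesis .
  qed
qed

lemma augmentation_le:
  assumes "valuation \<rho>"
  shows "augmentation \<rho> \<chi> \<beta> f \<le> \<rho> (coeff (expansion \<chi> f) s) + Fin (nmult s \<beta>)"
proof (cases "s \<le> degree (expansion \<chi> f)")
  case True
  then show ?thesis unfolding augmentation_def by (intro Min_le) auto
next
  case False
  then show ?thesis by (simp add: coeff_eq_0 val_zero[OF assms])
qed

lemma augmentation_attained:
  "\<exists>s. augmentation \<rho> \<chi> \<beta> f = \<rho> (coeff (expansion \<chi> f) s) + Fin (nmult s \<beta>)"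
proof -
  let ?t = "\<lambda>s. \<rho> (coeff (expansion \<chi> f) s) + Fin (nmult s \<beta>)"
  have "Min (?t ` {..degree (expansion \<chi> f)}) \<in> ?t ` {..degree (expansion \<chi> f)}"
    by (rule Min_in) auto
  then show ?thesis unfolding augmentation_def by blast
qed

section \<open>Taylor expansions\<close>

text \<open>
  The polynomial \<open>f(x + y)\<close> itself: as a ring homomorphism it is easier to handle than its coefficients.
\<close>

definition taylor :: "'a::field poly \<Rightarrow> 'a poly poly" where
  "taylor f = pcompose (map_poly (\<lambda>c. [:c:]) f) [:[:0, 1:], 1:]"

lemma coeff_taylor: "coeff (taylor f) b = hasse b f"
  by (simp add: taylor_def hasse_def)

lemma taylor_0 [simp]: "taylor 0 = 0"
  by (simp add: taylor_def)

lemma taylor_pCons: "taylor (pCons a p) = [:[:a:]:] + [:[:0, 1:], 1:] * taylor p"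
  by (simp add: taylor_def map_poly_pCons pcompose_pCons)

lemma taylor_add: "taylor (f + g) = taylor f + taylor g"
proof (induction f g rule: poly_induct2)
  case (pCons a p b q)
  have "taylor (pCons a p + pCons b q) = [:[:a + b:]:] + [:[:0, 1:], 1:] * (taylor p + taylor q)"
    by (simp only: add_pCons taylor_pCons pCons.IH)
  also have "\<dots> = ([:[:a:]:] + [:[:b:]:]) + [:[:0, 1:], 1:] * (taylor p + taylor q)"
    by simp
  also have "\<dots> = taylor (pCons a p) + taylor (pCons b q)"
    unfolding taylor_pCons by (simp only: algebra_simps)
  finally show ?case .
qed simp

lemma taylor_smult: "taylor (smult a f) = [:[:a:]:] * taylor f"
proof (induction f)
  case (pCons b f)
  have "[:[:a * b:]:] = [:[:a:]:] * [:[:b:]:]" by simp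
  then show ?case by (simp only: smult_pCons taylor_pCons pCons.IH) (simp only: algebra_simps)
qed simp

lemma taylor_mult: "taylor (f * g) = taylor f * taylor g"
proof (induction f)
  case (pCons a f)
  define X :: "'a poly poly" where "X = [:[:0, 1:], 1:]"
  have X: "taylor (pCons c p) = [:[:c:]:] + X * taylor p" for c :: 'a and p
    by (simp only: taylor_pCons X_def)
  have "taylor (pCons a f * g) = taylor (smult a g) + taylor (pCons 0 (f * g))"
    by (simp only: mult_pCons_left taylor_add)
  also have "taylor (pCons 0 (f * g)) = X * (taylor f * taylor g)"
    by (simp add: X pCons.IH)
  also have "taylor (smult a g) + \<dots> = taylor (pCons a f) * taylor g"
    by (simp only: taylor_smult X) (simp only: algebra_simps)
  finally show ?case .
qed simp

lemma taylor_1 [simp]: "taylor 1 = 1"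
  by (simp add: one_pCons taylor_pCons)

lemma taylor_power: "taylor (f ^ n) = taylor f ^ n"
  by (induction n) (simp_all add: taylor_mult)

lemma taylor_sum: "taylor (sum f A) = (\<Sum>i\<in>A. taylor (f i))"
  by (induction A rule: infinite_finite_induct) (simp_all add: taylor_add)

lemma hasse_add: "hasse b (f + g) = hasse b f + hasse b g"
  by (simp add: coeff_taylor[symmetric] taylor_add)

lemma hasse_zero [simp]: "hasse b 0 = 0"
  by (simp add: coeff_taylor[symmetric])

lemma hasse_pCons_0: "hasse 0 (pCons a p) = [:a:] + [:0, 1:] * hasse 0 p"
  and hasse_pCons_Suc: "hasse (Suc b) (pCons a p) = [:0, 1:] * hasse (Suc b) p + hasse b p"
  by (simp_all add: coeff_taylor[symmetric] taylor_pCons)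

lemma hasse_0 [simp]: "hasse 0 f = f"
  by (induction f) (simp_all add: hasse_pCons_0)

lemma hasse_degree: "degree (hasse b f) + b \<le> degree f \<or> hasse b f = 0"
proof (induction f arbitrary: b)
  case (pCons a p)
  show ?case
  proof (cases b)
    case (Suc n)
    show ?thesis
    proof (cases "p = 0")
      case False
      have "degree ([:0, 1:] * hasse (Suc n) p) + Suc n \<le> Suc (degree p) \<or> [:0, 1:] * hasse (Suc n) p = 0"
        using pCons.IH[of "Suc n"] by (auto simp: degree_pCons_eq_if)
      moreover have "degree (hasse n p) + Suc n \<le> Suc (degree p) \<or> hasse n p = 0"
        using pCons.IH[of n] by auto
      ultimately show ?thesis
        using degree_add_le_max[of "[:0, 1:] * hasse (Suc n) p" "hasse n p"] False
        unfolding Suc hasse_pCons_Suc by (auto simp del: mult_pCons_left)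
    qed (simp add: Suc hasse_pCons_Suc)
  qed simp
qed simp

lemma hasse_degree_less: "0 < b \<Longrightarrow> 0 < degree f \<Longrightarrow> degree (hasse b f) < degree f"
  using hasse_degree[of b f] by auto

lemma hasse_eq_0: "degree f < b \<Longrightarrow> hasse b f = 0"
  using hasse_degree[of b f] by auto

lemma hasse_top: "hasse (degree f) f = [:lead_coeff f:]"
proof (induction f)
  case (pCons a p)
  then show ?case
    by (cases "p = 0") (simp_all add: hasse_pCons_Suc hasse_eq_0)
qed simp

section \<open>Gauss valuations on polynomials over polynomials\<close>

text \<open>
  The value of the \<open>e\<close>-th term when the variable \<open>y\<close> has value \<open>\<eta>\<close>.
\<close>

definition weight ::
  "('a::field poly \<Rightarrow> 'g::linordered_ab_group_add topped) \<Rightarrow> 'g \<Rightarrow> 'a poly poly \<Rightarrow> nat \<Rightarrow> 'g topped" where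
  "weight \<mu> \<eta> Q e = \<mu> (coeff Q e) + Fin (nmult e \<eta>)"

text \<open>
  The Gauss value of \<open>Q\<close> is \<open>w\<close>, and the initial form of \<open>Q\<close> has degree \<open>n\<close> in \<open>y\<close>.
\<close>

definition last_min ::
  "('a::field poly \<Rightarrow> 'g::linordered_ab_group_add topped) \<Rightarrow> 'g \<Rightarrow> 'a poly poly \<Rightarrow> 'g \<Rightarrow> nat \<Rightarrow> bool" where
  "last_min \<mu> \<eta> Q w n \<longleftrightarrow>
     (\<forall>e. Fin w \<le> weight \<mu> \<eta> Q e) \<and> (\<forall>e>n. Fin w < weight \<mu> \<eta> Q e) \<and> weight \<mu> \<eta> Q n = Fin w"

context
  fixes \<mu> :: "'a::field poly \<Rightarrow> 'g::linordered_ab_group_add topped"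
  assumes \<mu>: "valuation \<mu>"
begin

lemma last_min_add:
  assumes P: "last_min \<mu> \<eta> P w n"
    and Q: "\<And>e. Fin w \<le> weight \<mu> \<eta> Q e" "\<And>e. n \<le> e \<Longrightarrow> Fin w < weight \<mu> \<eta> Q e"
  shows "last_min \<mu> \<eta> (P + Q) w n"
proof -
  have ge: "Fin w \<le> weight \<mu> \<eta> (P + Q) e" for e
    using P Q(1)[of e] unfolding last_min_def weight_def coeff_add Fin_le_add_Fin_iff
    by (auto intro: val_add_ge[OF \<mu>])
  have gt: "Fin w < weight \<mu> \<eta> (P + Q) e" if "e > n" for e
    using P Q(2)[of e] that unfolding last_min_def weight_def coeff_add Fin_less_add_Fin_iff
    by (auto intro: val_add_gt[OF \<mu>])
  have "weight \<mu> \<eta> P n < weight \<mu> \<eta> Q n" using P Q(2)[of n] by (simp add: last_min_def)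
  then have "\<mu> (coeff P n) < \<mu> (coeff Q n)"
    unfolding weight_def by (metis add_right_mono linorder_not_less)
  then have "weight \<mu> \<eta> (P + Q) n = weight \<mu> \<eta> P n"
    unfolding weight_def coeff_add by (simp add: val_add_eq[OF \<mu>])
  then show ?thesis using P ge gt by (simp add: last_min_def)
qed

text \<open>
  The Gauss lemma.  In the coefficient of the product at \<open>n + k\<close> only the product of the coefficients at
  \<open>n\<close> and \<open>k\<close> has minimal value: every other pair exceeds \<open>n\<close> or \<open>k\<close>.
\<close>

lemma last_min_mult:
  assumes P: "last_min \<mu> \<eta> P w n" and Q: "last_min \<mu> \<eta> Q v k"
  shows "last_min \<mu> \<eta> (P * Q) (w + v) (n + k)"
proof -
  define T where "T e i = coeff P i * coeff Q (e - i)" for e i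
  have coeff: "coeff (P * Q) e = (\<Sum>i\<le>e. T e i)" for e
    by (simp add: coeff_mult T_def)
  have T: "\<mu> (T e i) + Fin (nmult e \<eta>) = weight \<mu> \<eta> P i + weight \<mu> \<eta> Q (e - i)" if "i \<le> e" for e i
  proof -
    have "nmult e \<eta> = nmult i \<eta> + nmult (e - i) \<eta>"
      using nmult_add_left[of i "e - i" \<eta>] that by simp
    then have "Fin (nmult e \<eta>) = Fin (nmult i \<eta>) + Fin (nmult (e - i) \<eta>)" by simp
    then show ?thesis by (simp only: T_def val_mult[OF \<mu>] weight_def) (simp only: algebra_simps)
  qed
  have T_ge: "Fin (w + v - nmult e \<eta>) \<le> \<mu> (T e i)" if "i \<le> e" for e i
    using P Q unfolding Fin_le_add_Fin_iff[symmetric] T[OF that] last_min_def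
    by (intro topped_add_mono) auto
  have T_gt: "Fin (w + v - nmult e \<eta>) < \<mu> (T e i)" if "i \<le> e" "i > n \<or> e - i > k" for e i
    using that(2)
  proof
    assume "i > n"
    then show ?thesis
      using P Q topped_add_le_less_mono[of v "weight \<mu> \<eta> Q (e - i)" w "weight \<mu> \<eta> P i"]
      unfolding Fin_less_add_Fin_iff[symmetric] T[OF that(1)] last_min_def by (simp add: add.commute)
  next
    assume "e - i > k"
    then show ?thesis
      using P Q topped_add_le_less_mono[of w "weight \<mu> \<eta> P i" v "weight \<mu> \<eta> Q (e - i)"]
      unfolding Fin_less_add_Fin_iff[symmetric] T[OF that(1)] last_min_def by simp
  qed
  have ge: "Fin (w + v) \<le> weight \<mu> \<eta> (P * Q) e" for e
    unfolding weight_def coeff Fin_le_add_Fin_iff by (intro val_sum_ge[OF \<mu>] T_ge) auto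
  have gt: "Fin (w + v) < weight \<mu> \<eta> (P * Q) e" if "e > n + k" for e
    unfolding weight_def coeff Fin_less_add_Fin_iff using that
    by (intro val_sum_gt[OF \<mu>] T_gt) auto
  have "\<mu> (T (n + k) n) + Fin (nmult (n + k) \<eta>) = Fin (w + v)"
    using P Q by (simp add: T last_min_def)
  then have eq: "\<mu> (T (n + k) n) = Fin (w + v - nmult (n + k) \<eta>)"
    by (cases "\<mu> (T (n + k) n)") (auto simp: algebra_simps)
  have "coeff (P * Q) (n + k) = T (n + k) n + (\<Sum>i\<in>{..n + k} - {n}. T (n + k) i)"
    unfolding coeff by (rule sum.remove) auto
  moreover have "Fin (w + v - nmult (n + k) \<eta>) < \<mu> (\<Sum>i\<in>{..n + k} - {n}. T (n + k) i)"
    by (intro val_sum_gt[OF \<mu>] T_gt) auto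
  ultimately have "\<mu> (coeff (P * Q) (n + k)) = Fin (w + v - nmult (n + k) \<eta>)"
    using val_add_eq[OF \<mu>] eq by simp
  then have "weight \<mu> \<eta> (P * Q) (n + k) = Fin (w + v)"
    by (simp add: weight_def)
  then show ?thesis using ge gt by (simp add: last_min_def)
qed

lemma last_min_power:
  assumes "last_min \<mu> \<eta> P w n"
  shows "last_min \<mu> \<eta> (P ^ s) (nmult s w) (s * n)"
proof (induction s)
  case 0
  then show ?case by (auto simp: last_min_def weight_def val_one[OF \<mu>] val_zero[OF \<mu>] coeff_1)
next
  case (Suc s)
  then show ?case using last_min_mult[OF assms] by simp
qed

lemma last_min_exists:
  assumes "\<mu> (coeff Q 0) \<noteq> Infty"
  obtains w n where "last_min \<mu> \<eta> Q w n"
proof -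
  let ?W = "weight \<mu> \<eta> Q"
  define M where "M = Min (?W ` {..degree Q})"
  have M_le: "M \<le> ?W e" for e
  proof (cases "e \<le> degree Q")
    case True
    then show ?thesis unfolding M_def by (intro Min_le) auto
  next
    case False
    then show ?thesis by (simp add: weight_def coeff_eq_0 val_zero[OF \<mu>])
  qed
  have "M \<le> \<mu> (coeff Q 0)" using M_le[of 0] by (simp add: weight_def zero_topped_def[symmetric])
  then obtain w where w: "M = Fin w" using assms by (cases M) auto
  define S where "S = {e. ?W e = Fin w}"
  have "M \<in> ?W ` {..degree Q}" unfolding M_def by (rule Min_in) auto
  then have "S \<noteq> {}" using w by (auto simp: S_def)
  moreover have "S \<subseteq> {..degree Q}"
    using coeff_eq_0[of Q] by (force simp: S_def weight_def val_zero[OF \<mu>] not_le[symmetric])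
  then have fin: "finite S" by (rule finite_subset) simp
  ultimately have "Max S \<in> S" by (intro Max_in)
  moreover have "Fin w < ?W e" if "e > Max S" for e
  proof -
    have "e \<notin> S" using that fin Max_ge leD by blast
    then show ?thesis using M_le[of e] w by (auto simp: S_def order_less_le)
  qed
  ultimately show ?thesis using that[of w "Max S"] M_le w by (auto simp: last_min_def S_def)
qed

end

section \<open>Continuous MacLane chains\<close>

locale continuous_chain =
  fixes \<rho> :: "nat \<Rightarrow> 'a::field poly \<Rightarrow> 'g::linordered_ab_group_add topped"
    and \<chi> :: "nat \<Rightarrow> 'a poly" and \<beta> :: "nat \<Rightarrow> 'g" and m :: nat
  assumes chain: "continuous_MacLane_chain \<rho> \<chi> \<beta> m"
begin

lemma valuation_chain: "valuation (\<rho> i)"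
  using chain by (simp add: continuous_MacLane_chain_def)

lemma chain_step:
  shows key_poly: "\<chi> (Suc i) \<in> KP (\<rho> i)"
    and val_key_less: "\<rho> i (\<chi> (Suc i)) < Fin (\<beta> (Suc i))"
    and chain_Suc: "\<rho> (Suc i) = augmentation (\<rho> i) (\<chi> (Suc i)) (\<beta> (Suc i))"
    and degree_key: "degree (\<chi> (Suc i)) = m"
    and not_val_dvd_key: "\<not> val_dvd (\<rho> (Suc i)) (\<chi> (Suc (Suc i))) (\<chi> (Suc i))"
  using chain unfolding continuous_MacLane_chain_def by (metis diff_Suc_1 le_add1 plus_1_eq_Suc add.commute)+

lemma monic_key: "lead_coeff (\<chi> (Suc i)) = 1"
  using key_poly[of i] by (simp add: KP_def)

text \<open>
  There is no expansion in powers of a constant, so for \<open>m = 0\<close> the augmentation would be the same constant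
  on all polynomials, and could not tell \<open>0\<close> from \<open>1\<close>.
\<close>

lemma m_pos: "0 < m"
proof (rule ccontr)
  assume "\<not> 0 < m"
  then have "expansion (\<chi> (Suc 0)) f = (THE Q. False)" for f
    by (simp add: expansion_def degree_key)
  then have "\<rho> (Suc 0) 0 = \<rho> (Suc 0) 1"
    unfolding chain_Suc augmentation_def by simp
  then show False using val_zero[OF valuation_chain] val_one[OF valuation_chain] by simp
qed

lemma degree_key_pos: "0 < degree (\<chi> (Suc i))"
  using m_pos by (simp add: degree_key)

lemma val_low_step: "degree a < m \<Longrightarrow> \<rho> (Suc i) a = \<rho> i a"
proof -
  assume a: "degree a < m"
  have "expansion (\<chi> (Suc i)) a = [:a:]"
    using a m_pos by (intro expansion_eqI) (auto simp: degree_key coeff_pCons split: nat.split)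
  then show ?thesis
    by (simp add: chain_Suc augmentation_def zero_topped_def[symmetric])
qed

lemma val_low: "degree a < m \<Longrightarrow> \<rho> i a = \<rho> 0 a"
  by (induction i) (auto simp: val_low_step)

lemma val_low_finite: "degree a < m \<Longrightarrow> a \<noteq> 0 \<Longrightarrow> \<rho> 0 a \<noteq> Infty"
  using key_poly_finite[OF valuation_chain key_poly, of a 0] by (simp add: degree_key)

lemma val_key: "\<rho> (Suc i) (\<chi> (Suc i)) = Fin (\<beta> (Suc i))"
proof -
  have "expansion (\<chi> (Suc i)) (\<chi> (Suc i)) = [:0, 1:]"
    using degree_key_pos[of i] by (intro expansion_eqI) (auto simp: coeff_pCons split: nat.split)
  then show ?thesis
    by (simp add: chain_Suc augmentation_def val_zero[OF valuation_chain] val_one[OF valuation_chain]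
      atMost_Suc min_def)
qed

lemma chain_eq_term:
  obtains s where "\<rho> (Suc i) f = \<rho> (Suc i) (coeff (expansion (\<chi> (Suc i)) f) s * \<chi> (Suc i) ^ s)"
proof -
  obtain s where "\<rho> (Suc i) f = \<rho> i (coeff (expansion (\<chi> (Suc i)) f) s) + Fin (nmult s (\<beta> (Suc i)))"
    unfolding chain_Suc using augmentation_attained by blast
  moreover have "degree (coeff (expansion (\<chi> (Suc i)) f) s) < m"
    using expansion_degree[OF degree_key_pos] by (simp add: degree_key)
  ultimately show ?thesis using that[of s]
    by (simp add: val_mult[OF valuation_chain] val_power[OF valuation_chain val_key] val_low_step)
qed

lemma chain_le_term: "\<rho> (Suc i) f \<le> \<rho> (Suc i) (coeff (expansion (\<chi> (Suc i)) f) s * \<chi> (Suc i) ^ s)"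
proof -
  have "\<rho> (Suc i) f \<le> \<rho> i (coeff (expansion (\<chi> (Suc i)) f) s) + Fin (nmult s (\<beta> (Suc i)))"
    unfolding chain_Suc by (rule augmentation_le[OF valuation_chain])
  moreover have "degree (coeff (expansion (\<chi> (Suc i)) f) s) < m"
    using expansion_degree[OF degree_key_pos] by (simp add: degree_key)
  ultimately show ?thesis
    by (simp add: val_mult[OF valuation_chain] val_power[OF valuation_chain val_key] val_low_step)
qed

lemma term_mono:
  assumes "degree a < m"
  shows "\<rho> i (a * \<chi> (Suc i) ^ s) \<le> \<rho> (Suc i) (a * \<chi> (Suc i) ^ s)"
    and "a \<noteq> 0 \<Longrightarrow> 0 < s \<Longrightarrow> \<rho> i (a * \<chi> (Suc i) ^ s) < \<rho> (Suc i) (a * \<chi> (Suc i) ^ s)"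
proof -
  obtain b where b: "\<rho> i (\<chi> (Suc i)) = Fin b" "b < \<beta> (Suc i)"
    using val_key_less[of i] by (cases "\<rho> i (\<chi> (Suc i))") auto
  have eq: "\<rho> i (a * \<chi> (Suc i) ^ s) = \<rho> i a + Fin (nmult s b)"
    "\<rho> (Suc i) (a * \<chi> (Suc i) ^ s) = \<rho> i a + Fin (nmult s (\<beta> (Suc i)))"
    using assms by (simp_all add: val_mult[OF valuation_chain] val_power[OF valuation_chain b(1)]
      val_power[OF valuation_chain val_key] val_low_step)
  show "\<rho> i (a * \<chi> (Suc i) ^ s) \<le> \<rho> (Suc i) (a * \<chi> (Suc i) ^ s)"
    unfolding eq using b(2) by (intro add_left_mono) (simp add: nmult_mono)
  assume "a \<noteq> 0" "0 < s"
  then have "\<rho> i a \<noteq> Infty" using val_low_finite[of a] val_low[of a i] assms by simp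
  then show "\<rho> i (a * \<chi> (Suc i) ^ s) < \<rho> (Suc i) (a * \<chi> (Suc i) ^ s)"
    unfolding eq using b(2) \<open>0 < s\<close>
    by (cases "\<rho> i a") (auto simp: nmult_strict_mono)
qed

lemma key_le_term: "\<rho> i f \<le> \<rho> i (coeff (expansion (\<chi> (Suc i)) f) s * \<chi> (Suc i) ^ s)"
  using key_poly_expansion_le[OF valuation_chain key_poly, of "expansion (\<chi> (Suc i)) f" i s]
    expansion_props[OF degree_key_pos, of i f] by simp

lemma chain_mono_Suc: "\<rho> i f \<le> \<rho> (Suc i) f"
proof -
  obtain s where s: "\<rho> (Suc i) f = \<rho> (Suc i) (coeff (expansion (\<chi> (Suc i)) f) s * \<chi> (Suc i) ^ s)"
    by (rule chain_eq_term)
  have "degree (coeff (expansion (\<chi> (Suc i)) f) s) < m"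
    using expansion_degree[OF degree_key_pos] by (simp add: degree_key)
  then show ?thesis using key_le_term[of i f s] term_mono(1) s by (metis order_trans)
qed

lemma chain_mono: "i \<le> j \<Longrightarrow> \<rho> i f \<le> \<rho> j f"
  by (rule lift_Suc_mono_le[of "\<lambda>i. \<rho> i f"]) (rule chain_mono_Suc)

lemma chain_finite: "f \<noteq> 0 \<Longrightarrow> \<rho> i f \<noteq> Infty"
proof -
  assume f: "f \<noteq> 0"
  let ?Q = "expansion (\<chi> (Suc i)) f"
  have "poly ?Q (\<chi> (Suc i)) = f" by (rule poly_expansion[OF degree_key_pos])
  then have "?Q \<noteq> 0" using f by auto
  then obtain s where s: "coeff ?Q s \<noteq> 0" by (auto simp: poly_eq_iff)
  have "degree (coeff ?Q s) < m"
    using expansion_degree[OF degree_key_pos] by (simp add: degree_key)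
  then have "\<rho> (Suc i) (coeff ?Q s * \<chi> (Suc i) ^ s) \<noteq> Infty"
    using val_low_finite[of "coeff ?Q s"] val_low[of "coeff ?Q s" "Suc i"] s
    by (simp add: val_mult[OF valuation_chain] val_power[OF valuation_chain val_key])
  then show ?thesis
    using chain_le_term[of i f s] chain_mono_Suc[of i f] by (metis Infty_le_iff)
qed

text \<open>
  The two conditions on consecutive key polynomials pull in opposite directions.  Since \<open>\<chi>\<^bsub>i+1\<^esub>\<close> is a key
  polynomial for \<open>\<rho>\<^sub>i\<close>, the remainder of \<open>\<chi>\<^sub>i\<close> modulo \<open>\<chi>\<^bsub>i+1\<^esub>\<close> has value at least \<open>\<beta>\<^sub>i\<close>; since it does not divide
  \<open>\<chi>\<^sub>i\<close> in the graded algebra, this value is at most \<open>\<beta>\<^sub>i\<close>.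
\<close>

lemma key_diff:
  shows degree_key_diff: "degree (\<chi> (Suc (Suc i)) - \<chi> (Suc i)) < m"
    and val_key_diff: "\<rho> j (\<chi> (Suc (Suc i)) - \<chi> (Suc i)) = Fin (\<beta> (Suc i))"
    and \<beta>_less_Suc: "\<beta> (Suc i) < \<beta> (Suc (Suc i))"
proof -
  let ?a = "\<chi> (Suc (Suc i)) - \<chi> (Suc i)"
  have "degree ?a \<le> m" by (intro degree_diff_le) (simp_all add: degree_key)
  moreover have "coeff ?a m = 0"
    using monic_key[of i] monic_key[of "Suc i"] by (simp add: degree_key)
  ultimately show deg: "degree ?a < m"
    using m_pos by (metis degree_0 leading_coeff_0_iff order_le_less)
  then have "degree (- ?a) < degree (\<chi> (Suc (Suc i)))" by (simp only: degree_minus degree_key)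
  from key_poly_remainder[OF valuation_chain key_poly this, of 1]
  have "\<rho> (Suc i) (\<chi> (Suc i)) \<le> \<rho> (Suc i) (- ?a)" by simp
  then have ge: "Fin (\<beta> (Suc i)) \<le> \<rho> (Suc i) ?a"
    by (simp only: val_key val_minus[OF valuation_chain])
  have "\<not> \<rho> (Suc i) (\<chi> (Suc i)) < \<rho> (Suc i) (\<chi> (Suc i) - 1 * \<chi> (Suc (Suc i)))"
    using not_val_dvd_key[of i] val_dvdI[OF valuation_chain] by blast
  then have "\<rho> (Suc i) ?a \<le> Fin (\<beta> (Suc i))"
    using val_minus[OF valuation_chain, of "Suc i" ?a] by (simp add: val_key not_less)
  with ge have eq: "\<rho> (Suc i) ?a = Fin (\<beta> (Suc i))" by (rule antisym[rotated])
  then show "\<rho> j ?a = Fin (\<beta> (Suc i))"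
    using val_low[OF deg, of j] val_low[OF deg, of "Suc i"] by simp
  have "Fin (\<beta> (Suc i)) \<le> \<rho> (Suc i) (\<chi> (Suc i) + ?a)"
    by (intro val_add_ge[OF valuation_chain]) (simp_all only: val_key eq order_refl)
  also have "\<dots> < Fin (\<beta> (Suc (Suc i)))" using val_key_less[of "Suc i"] by simp
  finally show "\<beta> (Suc i) < \<beta> (Suc (Suc i))" by simp
qed

lemma \<beta>_strict_mono: "1 \<le> i \<Longrightarrow> i < j \<Longrightarrow> \<beta> i < \<beta> j"
proof -
  assume "1 \<le> i" "i < j"
  then have "i - 1 < j - 1" by simp
  with lift_Suc_mono_less[of "\<lambda>i. \<beta> (Suc i)", OF \<beta>_less_Suc]
  have "\<beta> (Suc (i - 1)) < \<beta> (Suc (j - 1))" .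
  then show ?thesis using \<open>1 \<le> i\<close> \<open>i < j\<close> by simp
qed

lemma \<beta>_mono: "1 \<le> i \<Longrightarrow> i \<le> j \<Longrightarrow> \<beta> i \<le> \<beta> j"
  using \<beta>_strict_mono[of i j] by (cases "i = j") auto

text \<open>
  If the constant term of the expansion strictly dominates the others, its value decides the value of
  \<open>f\<close>; this value does not change any more, because it is that of a polynomial of degree below \<open>m\<close>.  The
  criterion is applied to later members of the chain.
\<close>

lemma stable_criterion:
  assumes \<mu>: "valuation \<mu>" and le: "\<And>f. \<rho> (Suc j) f \<le> \<mu> f"
    and low_\<mu>: "\<And>a. degree a < m \<Longrightarrow> \<mu> a = \<rho> 0 a"
    and gt: "\<And>s. 0 < s \<Longrightarrow> \<rho> (Suc j) f < \<rho> (Suc j) (coeff (expansion (\<chi> (Suc j)) f) s * \<chi> (Suc j) ^ s)"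
  shows "\<mu> f = \<rho> (Suc j) f"
proof -
  let ?Q = "expansion (\<chi> (Suc j)) f"
  define T where "T s = coeff ?Q s * \<chi> (Suc j) ^ s" for s
  obtain s where "\<rho> (Suc j) f = \<rho> (Suc j) (T s)" unfolding T_def by (rule chain_eq_term)
  with gt[of s] have eq: "\<rho> (Suc j) f = \<rho> (Suc j) (T 0)" by (cases s) (auto simp: T_def)
  have deg: "degree (coeff ?Q 0) < m"
    using expansion_degree[OF degree_key_pos] by (simp add: degree_key)
  have eq': "\<mu> (T 0) = \<rho> (Suc j) f"
    using low_\<mu>[OF deg] val_low[OF deg, of "Suc j"] eq by (simp add: T_def)
  have "f = (\<Sum>s\<le>degree ?Q. T s)"
    using poly_expansion[OF degree_key_pos, of j f] by (simp add: T_def poly_altdef)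
  also have "\<dots> = T 0 + (\<Sum>s\<in>{..degree ?Q} - {0}. T s)" by (rule sum.remove) auto
  finally have f: "f = T 0 + (\<Sum>s\<in>{..degree ?Q} - {0}. T s)" .
  have "\<rho> (Suc j) f \<noteq> Infty" using gt[of 1] by auto
  then have "\<rho> (Suc j) f < \<mu> (\<Sum>s\<in>{..degree ?Q} - {0}. T s)"
    using gt le by (intro val_sum_gt[OF \<mu>]) (auto simp: T_def intro: less_le_trans)
  then have "\<mu> (T 0 + (\<Sum>s\<in>{..degree ?Q} - {0}. T s)) = \<mu> (T 0)"
    using eq' by (intro val_add_eq[OF \<mu>]) simp
  then show ?thesis using f eq' by simp
qed

text \<open>
  The terms other than the constant one increase strictly from \<open>\<rho>\<^sub>j\<close> to \<open>\<rho>\<^bsub>j+1\<^esub>\<close>.  If the value of \<open>f\<close> does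
  not, it must come from the constant term.
\<close>

lemma stable_step:
  assumes \<mu>: "valuation \<mu>" and le: "\<And>f. \<rho> (Suc j) f \<le> \<mu> f"
    and low_\<mu>: "\<And>a. degree a < m \<Longrightarrow> \<mu> a = \<rho> 0 a"
    and eq: "\<rho> (Suc j) f = \<rho> j f"
  shows "\<mu> f = \<rho> (Suc j) f"
proof (cases "f = 0")
  case True
  then show ?thesis by (simp add: val_zero[OF \<mu>] val_zero[OF valuation_chain])
next
  case False
  show ?thesis
  proof (rule stable_criterion[OF \<mu> le low_\<mu>])
    fix s :: nat assume s: "0 < s"
    let ?a = "coeff (expansion (\<chi> (Suc j)) f) s"
    have deg: "degree ?a < m"
      using expansion_degree[OF degree_key_pos] by (simp add: degree_key)
    show "\<rho> (Suc j) f < \<rho> (Suc j) (?a * \<chi> (Suc j) ^ s)"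
    proof (cases "?a = 0")
      case True
      then show ?thesis using chain_finite[OF False, of "Suc j"]
        by (cases "\<rho> (Suc j) f") (auto simp: val_zero[OF valuation_chain])
    next
      case a: False
      have "\<rho> (Suc j) f \<le> \<rho> j (?a * \<chi> (Suc j) ^ s)" using key_le_term[of j f s] eq by simp
      also have "\<dots> < \<rho> (Suc j) (?a * \<chi> (Suc j) ^ s)" by (rule term_mono(2)[OF deg a s])
      finally show ?thesis .
    qed
  qed
qed

lemma unstable_strict:
  assumes "\<not> stable \<rho> f" shows "\<rho> j f < \<rho> (Suc j) f"
proof (rule ccontr)
  assume "\<not> \<rho> j f < \<rho> (Suc j) f"
  then have eq: "\<rho> (Suc j) f = \<rho> j f" using chain_mono_Suc[of j f] by simp
  have "\<rho> i f = \<rho> (Suc j) f" if "Suc j \<le> i" for i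
    by (rule stable_step[OF valuation_chain chain_mono[OF that] val_low eq])
  then show False using assms unfolding stable_def by blast
qed

text \<open>
  The values of \<open>q a\<close> and \<open>r\<close> stay the same from \<open>\<rho>\<^sub>0\<close> to \<open>\<rho>\<^sub>1\<close>, while that of \<open>\<chi>\<^sub>1 = q a + r\<close> increases.  So
  there is cancellation: \<open>q a\<close> and \<open>r\<close> have the same value, below \<open>\<beta>\<^sub>1\<close>.
\<close>

lemma key_factor_value:
  assumes "degree q < m" "degree a < m" "degree r < m" and eq: "\<chi> (Suc 0) = q * a + r"
  shows "\<rho> 0 (q * a) = \<rho> 0 r" and "\<rho> 0 r < Fin (\<beta> (Suc 0))"
proof -
  let ?w = "\<rho> 0 (q * a)"
  have w: "\<rho> (Suc 0) (q * a) = ?w"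
    using assms by (simp add: val_mult[OF valuation_chain] val_low_step)
  have r: "\<rho> (Suc 0) r = \<rho> 0 r" using assms by (simp add: val_low_step)
  have r_eq: "r = \<chi> (Suc 0) - q * a" using eq by simp
  have lt: "?w < Fin (\<beta> (Suc 0))"
  proof (rule ccontr)
    assume "\<not> ?w < Fin (\<beta> (Suc 0))"
    then have ge: "Fin (\<beta> (Suc 0)) \<le> ?w" by simp
    have "Fin (\<beta> (Suc 0)) \<le> \<rho> (Suc 0) r"
      unfolding r_eq by (intro val_diff_ge[OF valuation_chain]) (simp_all add: val_key w ge)
    then have "Fin (\<beta> (Suc 0)) \<le> \<rho> 0 (q * a + r)"
      using ge r by (intro val_add_ge[OF valuation_chain]) simp_all
    then show False using val_key_less[of 0] eq by simp
  qed
  have "\<rho> (Suc 0) (- r) = ?w"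
  proof -
    have "\<rho> (Suc 0) (q * a + - \<chi> (Suc 0)) = \<rho> (Suc 0) (q * a)"
      by (intro val_add_eq[OF valuation_chain]) (simp add: w lt val_minus[OF valuation_chain] val_key)
    then show ?thesis using w by (simp add: r_eq)
  qed
  then show "?w = \<rho> 0 r" using r by (simp add: val_minus[OF valuation_chain])
  then show "\<rho> 0 r < Fin (\<beta> (Suc 0))" using lt by simp
qed

end

lemma hasse_degree_le: "degree (hasse e a) \<le> degree a"
  using hasse_degree[of e a] by auto

context continuous_chain
begin

abbreviation \<Gamma> :: "'g set" where "\<Gamma> \<equiv> stable_value_group \<rho>"

lemma \<Gamma>_closed:
  shows \<Gamma>_zero: "0 \<in> \<Gamma>"
    and \<Gamma>_add: "a \<in> \<Gamma> \<Longrightarrow> b \<in> \<Gamma> \<Longrightarrow> a + b \<in> \<Gamma>"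
    and \<Gamma>_diff: "a \<in> \<Gamma> \<Longrightarrow> b \<in> \<Gamma> \<Longrightarrow> a - b \<in> \<Gamma>"
    and \<Gamma>_nmult: "a \<in> \<Gamma> \<Longrightarrow> nmult n a \<in> \<Gamma>"
  unfolding stable_value_group_def using valuation_chain[of 1]
  by (auto intro: value_group_zero value_group_add value_group_diff value_group_nmult)

lemma \<Gamma>_low: "degree a < m \<Longrightarrow> \<rho> 0 a = Fin \<gamma> \<Longrightarrow> \<gamma> \<in> \<Gamma>"
  unfolding stable_value_group_def using val_low[of a 1] value_group_base[OF valuation_chain, of 1] by simp

lemma \<Gamma>_\<beta>: "\<beta> (Suc i) \<in> \<Gamma>"
  using \<Gamma>_low[OF degree_key_diff val_key_diff] .

lemma \<Gamma>_chain:
  assumes "\<rho> (Suc i) f = Fin \<gamma>" shows "\<gamma> \<in> \<Gamma>"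
proof -
  let ?a = "\<lambda>s. coeff (expansion (\<chi> (Suc i)) f) s"
  obtain s where s: "\<rho> (Suc i) f = \<rho> (Suc i) (?a s * \<chi> (Suc i) ^ s)" by (rule chain_eq_term)
  have deg: "degree (?a s) < m" using expansion_degree[OF degree_key_pos] by (simp add: degree_key)
  have "Fin \<gamma> = \<rho> 0 (?a s) + Fin (nmult s (\<beta> (Suc i)))"
    using s assms val_low[OF deg, of "Suc i"]
    by (simp add: val_mult[OF valuation_chain] val_power[OF valuation_chain val_key])
  then obtain \<alpha> where \<alpha>: "\<rho> 0 (?a s) = Fin \<alpha>" "\<gamma> = \<alpha> + nmult s (\<beta> (Suc i))"
    by (cases "\<rho> 0 (?a s)") auto
  then show ?thesis using \<Gamma>_low[OF deg \<alpha>(1)] by (simp add: \<Gamma>_add \<Gamma>_nmult \<Gamma>_\<beta>)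
qed

section \<open>Derivatives of polynomials of degree below the stable degree\<close>

text \<open>
  The Gauss valuation of weight \<open>c\<close> pulls back along \<open>taylor\<close> to a valuation \<open>w \<le> \<rho>\<^sub>1\<close>, and the claim is that
  \<open>w = \<rho>\<^sub>1\<close> in degrees below \<open>m\<close>.  The constant is chosen such that \<open>w(\<chi>\<^sub>1) = \<beta>\<^sub>1\<close>.  Let \<open>a\<close> be of minimal degree
  with \<open>w(a) < \<rho>\<^sub>1(a)\<close>, and write \<open>\<chi>\<^sub>1 = q a + r\<close>.  Then
  \<open>w(q a) = w(q) + w(a) < \<rho>\<^sub>1(q a) = \<rho>\<^sub>1(r) = w(r)\<close>, hence \<open>w(\<chi>\<^sub>1) = w(q a) < \<rho>\<^sub>1(r) < \<beta>\<^sub>1\<close>, a contradiction.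
\<close>

lemma hasse_low_bound:
  obtains c where "c \<in> \<Gamma>" "0 \<le> c"
    "\<And>a e. degree a < m \<Longrightarrow> \<rho> 0 a \<le> \<rho> 0 (hasse e a) + Fin (nmult e c)"
proof -
  let ?\<chi> = "\<chi> (Suc 0)" and ?\<beta> = "\<beta> (Suc 0)" and ?\<rho> = "\<rho> (Suc 0)"
  \<comment> \<open>A nonzero derivative of \<open>\<chi>\<^sub>1\<close> requires \<open>e c \<ge> g e\<close>; a vanishing one imposes no condition, hence the default \<open>0\<close>.\<close>
  define g where "g e = (case \<rho> 0 (hasse e ?\<chi>) of Fin x \<Rightarrow> ?\<beta> - x | Infty \<Rightarrow> 0)" for e
  define c where "c = Max (insert 0 (g ` {1..m}))"
  have hasse_key: "degree (hasse e ?\<chi>) < m" if "0 < e" for e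
    using hasse_degree_less[OF that degree_key_pos[of 0]] by (simp add: degree_key)
  have g_\<Gamma>: "g e \<in> \<Gamma>" if "0 < e" for e
    using \<Gamma>_low[OF hasse_key[OF that]] by (auto simp: g_def \<Gamma>_zero \<Gamma>_diff \<Gamma>_\<beta> split: topped.split)
  have "c \<in> insert 0 (g ` {1..m})" unfolding c_def by (intro Max_in) auto
  then have c_\<Gamma>: "c \<in> \<Gamma>" using g_\<Gamma> by (auto simp: \<Gamma>_zero)
  have c_nonneg: "0 \<le> c" unfolding c_def by (intro Max_ge) auto
  have key_ge: "Fin ?\<beta> \<le> ?\<rho> (hasse e ?\<chi>) + Fin (nmult e c)" for e
  proof (cases "e = 0 \<or> m < e")
    case True
    then show ?thesis by (auto simp: val_key hasse_eq_0 degree_key val_zero[OF valuation_chain])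
  next
    case False
    then have "g e \<le> c" unfolding c_def by (intro Max_ge) auto
    also have "c \<le> nmult e c" using c_nonneg False by (intro nmult_ge_self) auto
    finally have "g e \<le> nmult e c" .
    then show ?thesis using val_low[OF hasse_key, of e "Suc 0"] False
      by (cases "\<rho> 0 (hasse e ?\<chi>)") (auto simp: g_def algebra_simps)
  qed
  have "\<rho> 0 a \<le> \<rho> 0 (hasse e a) + Fin (nmult e c)" if "degree a < m" for a e
    using that
  proof (induction "degree a" arbitrary: a e rule: less_induct)
    case less
    show ?case
    proof (rule ccontr)
      assume "\<not> \<rho> 0 a \<le> \<rho> 0 (hasse e a) + Fin (nmult e c)"
      then have lt: "\<rho> 0 (hasse e a) + Fin (nmult e c) < \<rho> 0 a" by simp
      have "hasse e a \<noteq> 0" using lt by (auto simp: val_zero[OF valuation_chain])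
      moreover have "e \<noteq> 0" using lt by (intro notI) (simp add: zero_topped_def[symmetric])
      ultimately have deg_a: "0 < degree a" using hasse_degree[of e a] by auto
      define q r where "q = ?\<chi> div a" and "r = ?\<chi> mod a"
      have deg_r: "degree r < degree a" unfolding r_def by (rule degree_mod_lt[OF deg_a])
      have deg_q: "degree q < m"
        using degree_div_less[of ?\<chi> a] deg_a m_pos by (simp add: q_def degree_key)
      have eq: "?\<chi> = q * a + r" by (simp add: q_def r_def)
      have "q \<noteq> 0"
        using eq less.prems deg_r degree_key[of 0] by auto
      have r: "\<rho> 0 (q * a) = \<rho> 0 r" "\<rho> 0 r < Fin ?\<beta>"
        using key_factor_value[OF deg_q less.prems _ eq] deg_r less.prems by auto
      have "a \<noteq> 0" using deg_a by auto
      then have fin: "?\<rho> (coeff (taylor q) 0) \<noteq> Infty" "?\<rho> (coeff (taylor a) 0) \<noteq> Infty"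
        using \<open>q \<noteq> 0\<close> by (simp_all add: chain_finite coeff_taylor)
      obtain w n where lm1: "last_min ?\<rho> c (taylor q) w n"
        by (rule last_min_exists[OF valuation_chain fin(1)])
      obtain w' n' where lm2: "last_min ?\<rho> c (taylor a) w' n'"
        by (rule last_min_exists[OF valuation_chain fin(2)])
      note lm = lm1 lm2
      have w: "Fin w \<le> \<rho> 0 q"
        using lm(1) val_low[OF deg_q, of "Suc 0"] unfolding last_min_def weight_def coeff_taylor
        by (metis hasse_0 nmult_0 zero_topped_def add.right_neutral)
      have "Fin w' \<le> ?\<rho> (hasse e a) + Fin (nmult e c)"
        using lm(2) unfolding last_min_def weight_def coeff_taylor by blast
      then have w': "Fin w' < \<rho> 0 a"
        using lt val_low[OF le_less_trans[OF hasse_degree_le less.prems], of "Suc 0" e] by simp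
      \<comment> \<open>The exponent at which the Gauss minimum of \<open>q a\<close> is attained; the remainder is too large there to cancel it.\<close>
      define N where "N = n + n'"
      have qa: "?\<rho> (hasse N (q * a)) + Fin (nmult N c) = Fin (w + w')"
        using last_min_mult[OF valuation_chain lm]
        unfolding N_def last_min_def weight_def taylor_mult[symmetric] coeff_taylor by blast
      have ww: "Fin (w + w') < \<rho> 0 r"
        using topped_add_le_less_mono[OF w w'] r(1) by (simp add: val_mult[OF valuation_chain])
      also have "\<rho> 0 r \<le> \<rho> 0 (hasse N r) + Fin (nmult N c)"
        using less.hyps[OF deg_r] deg_r less.prems by simp
      also have "\<dots> = ?\<rho> (hasse N r) + Fin (nmult N c)"
        using val_low[of "hasse N r" "Suc 0"] hasse_degree_le[of N r] deg_r less.prems by simp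
      finally have "?\<rho> (hasse N (q * a)) + Fin (nmult N c) < ?\<rho> (hasse N r) + Fin (nmult N c)"
        by (simp only: qa)
      then have "?\<rho> (hasse N (q * a)) < ?\<rho> (hasse N r)"
        by (metis add_right_mono linorder_not_less)
      then have "?\<rho> (hasse N ?\<chi>) = ?\<rho> (hasse N (q * a))"
        unfolding eq hasse_add by (rule val_add_eq[OF valuation_chain])
      then have "Fin ?\<beta> \<le> Fin (w + w')" using key_ge[of N] qa by simp
      then show False using ww r(2) by (meson leD less_trans)
    qed
  qed
  then show ?thesis using that c_\<Gamma> c_nonneg by blast
qed

end

section \<open>The slopes of the key polynomials\<close>

locale unbounded_chain = continuous_chain +
  assumes unbounded: "\<not> (\<exists>\<gamma>\<in>stable_value_group \<rho>. \<forall>i\<ge>1. \<beta> i \<le> \<gamma>)"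
begin

lemma eventually_\<beta>_gt:
  assumes "\<gamma> \<in> \<Gamma>" shows "\<forall>\<^sub>F j in sequentially. \<gamma> < \<beta> j"
proof -
  obtain i where "1 \<le> i" "\<gamma> < \<beta> i" using unbounded assms by (meson not_le)
  then have "\<gamma> < \<beta> j" if "i \<le> j" for j using \<beta>_mono[of i j] that by simp
  then show ?thesis unfolding eventually_sequentially by blast
qed

text \<open>
  The inequality says that the slope of \<open>\<chi>\<^sub>j\<close> at \<open>e\<close> is smaller than the slope \<open>(\<beta>\<^sub>j - \<delta>)/b\<close> at \<open>b\<close>, cleared of
  denominators.  Let \<open>S\<close> consist of the \<open>e \<ge> 1\<close> for which the value of \<open>\<partial>\<^sub>e \<chi>\<^sub>j\<close> falls below \<open>\<beta>\<^sub>j - ec\<close> at some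
  \<open>j\<close>; from there on it is constant, as the corrections \<open>\<chi>\<^bsub>j+1\<^esub> - \<chi>\<^sub>j\<close> contribute larger values only.  Then
  slopes at \<open>e \<notin> S\<close> are bounded by \<open>c\<close>, and those at \<open>e \<in> S\<close> grow like \<open>\<beta>\<^sub>j/e\<close>, so that \<open>b\<close> is the least
  element of \<open>S\<close>.
\<close>

lemma key_hasse_dominance:
  assumes c: "c \<in> \<Gamma>" "0 \<le> c"
    and bound: "\<And>a e. degree a < m \<Longrightarrow> \<rho> 0 a \<le> \<rho> 0 (hasse e a) + Fin (nmult e c)"
  obtains b \<delta> where "0 < b" "\<delta> \<in> \<Gamma>"
    "\<forall>\<^sub>F j in sequentially. \<rho> 0 (hasse b (\<chi> j)) = Fin \<delta>"
    "\<forall>\<^sub>F j in sequentially. \<forall>e. 0 < e \<longrightarrow> e \<noteq> b \<longrightarrow>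
       Fin (nmult b (\<beta> j)) < nmult b (\<rho> 0 (hasse e (\<chi> j))) + Fin (nmult e (\<beta> j - \<delta>))"
proof -
  define D where "D e j = \<rho> 0 (hasse e (\<chi> (Suc j)))" for e j
  have hasse_key: "degree (hasse e (\<chi> (Suc j))) < m" if "0 < e" for e j
    using hasse_degree_less[OF that degree_key_pos[of j]] by (simp add: degree_key)
  have const: "D e j = D e N" if "0 < e" "D e N < Fin (\<beta> (Suc N) - nmult e c)" "N \<le> j" for e j N
    using that(3)
  proof (induction j rule: dec_induct)
    case (step j)
    let ?a = "\<chi> (Suc (Suc j)) - \<chi> (Suc j)"
    have "\<beta> (Suc N) \<le> \<beta> (Suc j)" using step by (intro \<beta>_mono) auto
    then have "D e j < Fin (\<beta> (Suc j) - nmult e c)"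
      unfolding step.IH by (intro less_le_trans[OF that(2)]) simp
    also have "\<dots> \<le> \<rho> 0 (hasse e ?a)"
      using bound[OF degree_key_diff[of j], of e] unfolding val_key_diff Fin_le_add_Fin_iff .
    finally have "\<rho> 0 (hasse e (\<chi> (Suc j)) + hasse e ?a) = D e j"
      unfolding D_def by (rule val_add_eq[OF valuation_chain])
    then show ?case using step.IH by (simp add: hasse_add[symmetric] D_def)
  qed simp
  define S where "S = {e. 0 < e \<and> (\<exists>N. D e N < Fin (\<beta> (Suc N) - nmult e c))}"
  \<comment> \<open>\<open>\<chi>\<^sub>j\<close> is monic of degree \<open>m\<close>, so \<open>\<partial>\<^sub>m \<chi>\<^sub>j = 1\<close> has value \<open>0\<close>.\<close>
  have "m \<in> S"
  proof -
    obtain i where i: "1 \<le> i" "nmult m c < \<beta> i"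
      using unbounded \<Gamma>_nmult[OF c(1)] by (meson not_le)
    then obtain N where "i = Suc N" by (cases i) auto
    moreover have "D m N = Fin 0"
      using hasse_top[of "\<chi> (Suc N)"] monic_key[of N] val_one[OF valuation_chain, of 0]
      by (simp add: D_def degree_key one_pCons)
    ultimately show ?thesis using i m_pos unfolding S_def by (auto intro!: exI[of _ N])
  qed
  define b where "b = (LEAST e. e \<in> S)"
  have b: "b \<in> S" unfolding b_def using \<open>m \<in> S\<close> by (rule LeastI)
  then have b_pos: "0 < b" by (simp add: S_def)
  have b_least: "b \<le> e" if "e \<in> S" for e unfolding b_def using that by (rule Least_le)
  have limit: "\<exists>\<delta>\<in>\<Gamma>. \<forall>\<^sub>F j in sequentially. \<rho> 0 (hasse e (\<chi> j)) = Fin \<delta>" if "e \<in> S" for e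
  proof -
    from that obtain N where e: "0 < e" and N: "D e N < Fin (\<beta> (Suc N) - nmult e c)"
      by (auto simp: S_def)
    obtain \<delta> where \<delta>: "D e N = Fin \<delta>" using N by (cases "D e N") auto
    then have "\<delta> \<in> \<Gamma>" using \<Gamma>_low[OF hasse_key[OF e]] by (simp add: D_def)
    moreover have "\<rho> 0 (hasse e (\<chi> j)) = Fin \<delta>" if "Suc N \<le> j" for j
      using const[OF e N, of "j - 1"] that \<delta> by (cases j) (auto simp: D_def)
    ultimately show ?thesis unfolding eventually_sequentially by blast
  qed
  obtain \<delta> where \<delta>: "\<delta> \<in> \<Gamma>" "\<forall>\<^sub>F j in sequentially. \<rho> 0 (hasse b (\<chi> j)) = Fin \<delta>"
    using limit[OF b] by blast
  have dom: "\<forall>\<^sub>F j in sequentially.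
      Fin (nmult b (\<beta> j)) < nmult b (\<rho> 0 (hasse e (\<chi> j))) + Fin (nmult e (\<beta> j - \<delta>))"
    if e: "0 < e" "e \<noteq> b" for e
  proof (cases "e \<in> S")
    case True
    then have "b < e" using b_least e(2) by (simp add: order_less_le)
    obtain \<delta>' where \<delta>': "\<delta>' \<in> \<Gamma>" "\<forall>\<^sub>F j in sequentially. \<rho> 0 (hasse e (\<chi> j)) = Fin \<delta>'"
      using limit[OF True] by blast
    have "\<forall>\<^sub>F j in sequentially. nmult e \<delta> - nmult b \<delta>' < \<beta> j"
      by (intro eventually_\<beta>_gt \<Gamma>_diff \<Gamma>_nmult \<delta>(1) \<delta>'(1))
    then show ?thesis using \<delta>'(2) eventually_\<beta>_gt[OF \<Gamma>_zero]
    proof eventually_elim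
      case (elim j)
      have "\<beta> j \<le> nmult (e - b) (\<beta> j)" using elim(3) \<open>b < e\<close> by (intro nmult_ge_self) auto
      then have "nmult e \<delta> - nmult b \<delta>' < nmult e (\<beta> j) - nmult b (\<beta> j)"
        using elim(1) \<open>b < e\<close> by (simp add: nmult_diff_left)
      then show ?case using elim(2) by (simp add: nmult_Fin nmult_diff_right algebra_simps)
    qed
  next
    case False
    have "\<forall>\<^sub>F j in sequentially. nmult b c + \<delta> < \<beta> j"
      by (intro eventually_\<beta>_gt \<Gamma>_add \<Gamma>_nmult \<delta>(1) c)
    then show ?thesis using eventually_ge_at_top[of 1]
    proof eventually_elim
      case (elim j)
      then obtain i where j: "j = Suc i" by (cases j) auto
      have "Fin (\<beta> j - nmult e c) \<le> \<rho> 0 (hasse e (\<chi> j))"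
        using False e(1) by (auto simp: S_def D_def j not_less)
      then have "nmult b (Fin (\<beta> j - nmult e c)) \<le> nmult b (\<rho> 0 (hasse e (\<chi> j)))"
        using b_pos by (intro nmult_topped_mono)
      then have ge: "Fin (nmult b (\<beta> j) - nmult b (nmult e c)) \<le> nmult b (\<rho> 0 (hasse e (\<chi> j)))"
        by (simp add: nmult_Fin nmult_diff_right)
      have "nmult e (nmult b c) < nmult e (\<beta> j - \<delta>)"
        using elim(1) e(1) by (intro nmult_strict_mono) (auto simp: algebra_simps)
      then have "nmult b (\<beta> j) < nmult b (\<beta> j) - nmult b (nmult e c) + nmult e (\<beta> j - \<delta>)"
        by (simp add: nmult_nmult mult.commute algebra_simps)
      then have "Fin (nmult b (\<beta> j)) < Fin (nmult b (\<beta> j) - nmult b (nmult e c)) + Fin (nmult e (\<beta> j - \<delta>))"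
        by simp
      also have "\<dots> \<le> nmult b (\<rho> 0 (hasse e (\<chi> j))) + Fin (nmult e (\<beta> j - \<delta>))"
        by (intro add_right_mono ge)
      finally show ?case .
    qed
  qed
  have "\<forall>\<^sub>F j in sequentially. \<forall>e\<in>{..m} - {0, b}.
      Fin (nmult b (\<beta> j)) < nmult b (\<rho> 0 (hasse e (\<chi> j))) + Fin (nmult e (\<beta> j - \<delta>))"
    by (intro eventually_ball_finite ballI dom) auto
  then have "\<forall>\<^sub>F j in sequentially. \<forall>e. 0 < e \<longrightarrow> e \<noteq> b \<longrightarrow>
      Fin (nmult b (\<beta> j)) < nmult b (\<rho> 0 (hasse e (\<chi> j))) + Fin (nmult e (\<beta> j - \<delta>))"
    using eventually_ge_at_top[of 1]
  proof eventually_elim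
    case (elim j)
    then obtain i where j: "j = Suc i" by (cases j) auto
    show ?case
    proof (intro allI impI)
      fix e assume e: "0 < e" "e \<noteq> b"
      show "Fin (nmult b (\<beta> j)) < nmult b (\<rho> 0 (hasse e (\<chi> j))) + Fin (nmult e (\<beta> j - \<delta>))"
      proof (cases "e \<le> m")
        case True
        then show ?thesis using elim(1) e by simp
      next
        case False
        then have "hasse e (\<chi> j) = 0" by (intro hasse_eq_0) (simp add: j degree_key)
        then show ?thesis using b_pos by (simp add: val_zero[OF valuation_chain] nmult_Infty)
      qed
    qed
  qed
  then show ?thesis using that[OF b_pos \<delta>] by blast
qed

end

section \<open>The numerical character and the multiplicity\<close>

lemma weight_sum_ge:
  assumes "valuation \<mu>" "\<And>i. i \<in> A \<Longrightarrow> Fin w \<le> weight \<mu> \<eta> (taylor (f i)) e"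
  shows "Fin w \<le> weight \<mu> \<eta> (taylor (sum f A)) e"
  using assms(2) unfolding weight_def Fin_le_add_Fin_iff taylor_sum coeff_sum
  by (intro val_sum_ge[OF assms(1)])

lemma weight_sum_gt:
  assumes "valuation \<mu>" "\<And>i. i \<in> A \<Longrightarrow> Fin w < weight \<mu> \<eta> (taylor (f i)) e"
  shows "Fin w < weight \<mu> \<eta> (taylor (sum f A)) e"
  using assms(2) unfolding weight_def Fin_less_add_Fin_iff taylor_sum coeff_sum
  by (intro val_sum_gt[OF assms(1)]) auto

lemma nmult_le_add_imp_le: "nmult n a \<le> nmult k a + x \<Longrightarrow> k < n \<Longrightarrow> 0 \<le> a \<Longrightarrow> a \<le> x"
  for a :: "'g::linordered_ab_group_add"
proof -
  assume le: "nmult n a \<le> nmult k a + x" and "k < n" "0 \<le> a"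
  then have "a \<le> nmult (n - k) a" by (intro nmult_ge_self) auto
  also have "\<dots> = nmult n a - nmult k a" using \<open>k < n\<close> by (simp add: nmult_diff_left)
  also have "\<dots> \<le> x" using le by (simp add: algebra_simps)
  finally show "a \<le> x" .
qed

context continuous_chain
begin

lemma t_index_set:
  fixes f :: "'a poly" and i :: nat
  assumes "f \<noteq> 0"
  defines "S \<equiv> {s. \<rho> (Suc i) (coeff (expansion (\<chi> (Suc i)) f) s * \<chi> (Suc i) ^ s) = \<rho> (Suc i) f}"
  shows "finite S" "S \<noteq> {}"
proof -
  have "S \<subseteq> {..degree (expansion (\<chi> (Suc i)) f)}"
  proof
    fix s assume "s \<in> S"
    then have "coeff (expansion (\<chi> (Suc i)) f) s \<noteq> 0"
      using chain_finite[OF assms(1), of "Suc i"] by (auto simp: S_def val_zero[OF valuation_chain])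
    then show "s \<in> {..degree (expansion (\<chi> (Suc i)) f)}" by (simp add: le_degree)
  qed
  then show "finite S" by (rule finite_subset) simp
  obtain s where "\<rho> (Suc i) f = \<rho> (Suc i) (coeff (expansion (\<chi> (Suc i)) f) s * \<chi> (Suc i) ^ s)"
    by (rule chain_eq_term)
  then have "s \<in> S" by (simp add: S_def)
  then show "S \<noteq> {}" by blast
qed

lemma t_index_attains:
  fixes f :: "'a poly" and i :: nat
  assumes "f \<noteq> 0"
  defines "t \<equiv> t_index (\<rho> (Suc i)) (\<chi> (Suc i)) f"
  shows "\<rho> (Suc i) (coeff (expansion (\<chi> (Suc i)) f) t * \<chi> (Suc i) ^ t) = \<rho> (Suc i) f"
    and "t < s \<Longrightarrow> \<rho> (Suc i) f < \<rho> (Suc i) (coeff (expansion (\<chi> (Suc i)) f) s * \<chi> (Suc i) ^ s)"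
proof -
  let ?S = "{s. \<rho> (Suc i) (coeff (expansion (\<chi> (Suc i)) f) s * \<chi> (Suc i) ^ s) = \<rho> (Suc i) f}"
  note S = t_index_set[OF assms(1), of i]
  have t: "t = Max ?S" by (simp add: t_def t_index_def)
  then have "t \<in> ?S" using S Max_in by blast
  then show "\<rho> (Suc i) (coeff (expansion (\<chi> (Suc i)) f) t * \<chi> (Suc i) ^ t) = \<rho> (Suc i) f" by simp
  assume "t < s"
  then have "s \<notin> ?S" using S t Max_ge leD by blast
  then show "\<rho> (Suc i) f < \<rho> (Suc i) (coeff (expansion (\<chi> (Suc i)) f) s * \<chi> (Suc i) ^ s)"
    using chain_le_term[of i f s] by (auto simp: order_less_le)
qed

lemma unstable_nonzero: "\<not> stable \<rho> f \<Longrightarrow> f \<noteq> 0"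
  using val_zero[OF valuation_chain] by (auto simp: stable_def)

text \<open>
  If only the constant term of the expansion were of minimal value, \<open>f\<close> would be stable.
\<close>

lemma t_index_pos:
  assumes "\<not> stable \<rho> f" shows "0 < t_index (\<rho> (Suc i)) (\<chi> (Suc i)) f"
proof (rule ccontr)
  assume "\<not> ?thesis"
  then have "\<rho> (Suc (Suc i)) f = \<rho> (Suc i) f"
    using t_index_attains(2)[OF unstable_nonzero[OF assms], of i]
    by (intro stable_criterion[OF valuation_chain chain_mono_Suc val_low]) auto
  then show False using unstable_strict[OF assms, of "Suc i"] by simp
qed

text \<open>
  The weight \<open>\<eta>/b\<close> of \<open>y\<close> exceeds the constant \<open>c\<close>, so the inequalities of \<open>hasse_low_bound\<close> become strict.
\<close>

lemma last_min_low:
  assumes b: "0 < b" and bound: "\<And>a e. degree a < m \<Longrightarrow> \<rho> 0 a \<le> \<rho> 0 (hasse e a) + Fin (nmult e c)"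
    and \<eta>: "nmult b c < \<eta>" and a: "degree a < m" "\<rho> 0 a = Fin \<alpha>"
  shows "last_min (\<lambda>f. nmult b (\<rho> j f)) \<eta> (taylor a) (nmult b \<alpha>) 0"
proof -
  have gt: "Fin (nmult b \<alpha>) < nmult b (\<rho> 0 (hasse e a)) + Fin (nmult e \<eta>)" if "0 < e" for e
  proof -
    have "Fin (\<alpha> - nmult e c) \<le> \<rho> 0 (hasse e a)"
      using bound[OF a(1), of e] unfolding a(2) Fin_le_add_Fin_iff .
    then have "nmult b (Fin (\<alpha> - nmult e c)) \<le> nmult b (\<rho> 0 (hasse e a))"
      using b by (intro nmult_topped_mono)
    then have ge: "Fin (nmult b \<alpha> - nmult b (nmult e c)) \<le> nmult b (\<rho> 0 (hasse e a))"
      by (simp add: nmult_Fin nmult_diff_right)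
    have "nmult e (nmult b c) < nmult e \<eta>" using \<eta> that by (intro nmult_strict_mono)
    then have "Fin (nmult b \<alpha>) < Fin (nmult b \<alpha> - nmult b (nmult e c)) + Fin (nmult e \<eta>)"
      by (simp add: nmult_nmult mult.commute algebra_simps)
    also have "\<dots> \<le> nmult b (\<rho> 0 (hasse e a)) + Fin (nmult e \<eta>)"
      by (intro add_right_mono ge)
    finally show ?thesis .
  qed
  have weight: "weight (\<lambda>f. nmult b (\<rho> j f)) \<eta> (taylor a) e = nmult b (\<rho> 0 (hasse e a)) + Fin (nmult e \<eta>)" for e
    using val_low[OF le_less_trans[OF hasse_degree_le a(1)], of j] by (simp add: weight_def coeff_taylor)
  have 0: "weight (\<lambda>f. nmult b (\<rho> j f)) \<eta> (taylor a) 0 = Fin (nmult b \<alpha>)"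
    unfolding weight by (simp add: a(2) nmult_Fin)
  have gt': "Fin (nmult b \<alpha>) < weight (\<lambda>f. nmult b (\<rho> j f)) \<eta> (taylor a) e" if "0 < e" for e
    unfolding weight by (rule gt[OF that])
  have "Fin (nmult b \<alpha>) \<le> weight (\<lambda>f. nmult b (\<rho> j f)) \<eta> (taylor a) e" for e
  proof (cases "e = 0")
    case True
    then show ?thesis by (simp only: 0 order_refl)
  next
    case False
    then show ?thesis using gt'[of e] by (simp only: less_imp_le neq0_conv)
  qed
  then show ?thesis using gt' 0 unfolding last_min_def by blast
qed

text \<open>
  By multiplicativity the term \<open>a\<^sub>s \<chi>\<^sup>s\<close> has its last minimum at the exponent \<open>s b\<close>, and Gauss value equal to
  its value.  Terms with \<open>s > t\<close> have a larger Gauss value than the \<open>t\<close>-th one, and those with \<open>s < t\<close> have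
  their last minimum before \<open>t b\<close>; neither affects the last minimum of the sum.
\<close>

lemma last_min_taylor:
  fixes i b :: nat and c \<delta> :: 'g and f :: "'a poly"
  defines "j \<equiv> Suc i"
  defines "\<eta> \<equiv> \<beta> j - \<delta>"
  assumes b: "0 < b"
    and bound: "\<And>a e. degree a < m \<Longrightarrow> \<rho> 0 a \<le> \<rho> 0 (hasse e a) + Fin (nmult e c)"
    and \<eta>_gt: "nmult b c < \<eta>"
    and \<delta>: "\<rho> 0 (hasse b (\<chi> j)) = Fin \<delta>"
    and dom: "\<And>e. 0 < e \<Longrightarrow> e \<noteq> b \<Longrightarrow>
       Fin (nmult b (\<beta> j)) < nmult b (\<rho> 0 (hasse e (\<chi> j))) + Fin (nmult e \<eta>)"
    and f: "\<rho> j f = Fin v"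
  shows "last_min (\<lambda>f. nmult b (\<rho> j f)) \<eta> (taylor f) (nmult b v) (t_index (\<rho> j) (\<chi> j) f * b)"
proof -
  define \<mu> where "\<mu> f = nmult b (\<rho> j f)" for f
  have \<mu>: "valuation \<mu>" unfolding \<mu>_def by (rule valuation_scale[OF valuation_chain b])
  have hasse_key: "degree (hasse e (\<chi> j)) < m" if "0 < e" for e
    using hasse_degree_less[OF that degree_key_pos[of i]] by (simp add: degree_key j_def)
  have key_0: "weight \<mu> \<eta> (taylor (\<chi> j)) 0 = Fin (nmult b (\<beta> j))"
    by (simp add: weight_def coeff_taylor \<mu>_def j_def val_key nmult_Fin)
  have key_b: "weight \<mu> \<eta> (taylor (\<chi> j)) b = Fin (nmult b (\<beta> j))"
  proof -
    have "\<rho> j (hasse b (\<chi> j)) = Fin \<delta>" using val_low[OF hasse_key[OF b], of j] \<delta> by (rule trans)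
    then have "weight \<mu> \<eta> (taylor (\<chi> j)) b = Fin (nmult b \<delta> + nmult b \<eta>)"
      by (simp only: weight_def coeff_taylor \<mu>_def nmult_Fin plus_topped.simps)
    also have "nmult b \<delta> + nmult b \<eta> = nmult b (\<beta> j)"
      unfolding \<eta>_def nmult_diff_right by simp
    finally show ?thesis .
  qed
  have key_e: "Fin (nmult b (\<beta> j)) < weight \<mu> \<eta> (taylor (\<chi> j)) e" if "0 < e" "e \<noteq> b" for e
    using dom[OF that] val_low[OF hasse_key[OF that(1)], of j] by (simp add: weight_def coeff_taylor \<mu>_def)
  have key_ge: "Fin (nmult b (\<beta> j)) \<le> weight \<mu> \<eta> (taylor (\<chi> j)) e" for e
    using key_0 key_b key_e[of e] by (cases "e = 0 \<or> e = b") (auto simp: less_imp_le)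
  have key: "last_min \<mu> \<eta> (taylor (\<chi> j)) (nmult b (\<beta> j)) b"
    unfolding last_min_def using key_ge key_e key_b b by auto
  have f0: "f \<noteq> 0" using f by (auto simp: val_zero[OF valuation_chain])
  let ?Q = "expansion (\<chi> j) f"
  define T where "T s = coeff ?Q s * \<chi> j ^ s" for s
  define t where "t = t_index (\<rho> j) (\<chi> j) f"
  have deg: "degree (coeff ?Q s) < m" for s
    using expansion_degree[OF degree_key_pos[of i]] by (simp add: degree_key j_def)
  have T: "last_min \<mu> \<eta> (taylor (T s)) (nmult b w) (s * b)" if Tw: "\<rho> j (T s) = Fin w" for s w
  proof -
    have "\<rho> j (T s) = \<rho> 0 (coeff ?Q s) + Fin (nmult s (\<beta> j))"
      unfolding T_def using val_low[OF deg, of j s]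
      by (simp add: val_mult[OF valuation_chain] j_def val_power[OF valuation_chain val_key])
    then have "Fin w = \<rho> 0 (coeff ?Q s) + Fin (nmult s (\<beta> j))" unfolding Tw .
    then obtain \<alpha> where \<alpha>: "\<rho> 0 (coeff ?Q s) = Fin \<alpha>" "w = \<alpha> + nmult s (\<beta> j)"
      by (cases "\<rho> 0 (coeff ?Q s)") auto
    have "last_min \<mu> \<eta> (taylor (coeff ?Q s)) (nmult b \<alpha>) 0"
      unfolding \<mu>_def by (rule last_min_low[OF b bound \<eta>_gt deg \<alpha>(1)])
    from last_min_mult[OF \<mu> this last_min_power[OF \<mu> key, of s]]
    show ?thesis
      by (simp add: T_def taylor_mult taylor_power \<alpha>(2) nmult_add_right nmult_nmult mult.commute)
  qed
  have T_ge: "Fin v \<le> \<rho> j (T s)" for s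
    using chain_le_term[of i f s] f by (simp add: T_def j_def)
  have T_gt: "Fin v < \<rho> j (T s)" if "t < s" for s
    using t_index_attains(2)[OF f0, of i s] that f by (simp add: T_def j_def t_def)
  have T_t: "\<rho> j (T t) = Fin v"
    using t_index_attains(1)[OF f0, of i] f by (simp add: T_def j_def t_def)
  have W_ge: "Fin (nmult b v) \<le> weight \<mu> \<eta> (taylor (T s)) e" for s e
  proof (cases "\<rho> j (T s)")
    case (Fin w)
    then have "nmult b v \<le> nmult b w" using T_ge[of s] by (simp add: nmult_mono)
    then show ?thesis using T[OF Fin] unfolding last_min_def
      by (meson less_eq_topped.simps(3) order_trans)
  next
    case Infty
    then have "T s = 0" using chain_finite by blast
    then show ?thesis by (simp add: weight_def val_zero[OF \<mu>])
  qed
  have W_gt: "Fin (nmult b v) < weight \<mu> \<eta> (taylor (T s)) e" if "s \<noteq> t" "t * b \<le> e" for s e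
  proof (cases "\<rho> j (T s)")
    case (Fin w)
    show ?thesis
    proof (cases "t < s")
      case True
      then have "nmult b v < nmult b w" using T_gt[of s] Fin b by (simp add: nmult_strict_mono)
      then show ?thesis using T[OF Fin] unfolding last_min_def
        by (meson Fin_less_iff less_le_trans)
    next
      case False
      then have "s * b < e" using that b by (meson le_neq_implies_less less_le_trans mult_less_mono1 not_less)
      moreover have "nmult b v \<le> nmult b w" using T_ge[of s] Fin by (simp add: nmult_mono)
      ultimately show ?thesis using T[OF Fin] unfolding last_min_def
        by (meson less_eq_topped.simps(3) le_less_trans)
    qed
  next
    case Infty
    then have "T s = 0" using chain_finite by blast
    then show ?thesis by (simp add: weight_def val_zero[OF \<mu>])
  qed
  have "f = (\<Sum>s\<le>degree ?Q. T s)"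
    using poly_expansion[OF degree_key_pos, of i f] by (simp add: T_def poly_altdef j_def)
  also have "\<dots> = T t + (\<Sum>s\<in>{..degree ?Q} - {t}. T s)"
  proof (rule sum.remove)
    have "T t \<noteq> 0" using T_t by (auto simp: val_zero[OF valuation_chain])
    then show "t \<in> {..degree ?Q}" by (auto simp: T_def intro: le_degree)
  qed simp
  finally have "taylor f = taylor (T t) + taylor (\<Sum>s\<in>{..degree ?Q} - {t}. T s)"
    by (simp add: taylor_add[symmetric])
  moreover have "last_min \<mu> \<eta> (taylor (T t) + taylor (\<Sum>s\<in>{..degree ?Q} - {t}. T s)) (nmult b v) (t * b)"
    by (intro last_min_add[OF \<mu> T[OF T_t]] weight_sum_ge[OF \<mu>] weight_sum_gt[OF \<mu>] W_ge W_gt) auto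
  ultimately show ?thesis by (simp add: \<mu>_def[abs_def] t_def)
qed

lemma stable_value_in_\<Gamma>:
  assumes "stable \<rho> f" "f \<noteq> 0"
  obtains \<gamma> where "\<gamma> \<in> \<Gamma>" "\<forall>\<^sub>F j in sequentially. \<rho> j f = Fin \<gamma>"
proof -
  obtain N where N: "\<And>i. i \<ge> N \<Longrightarrow> \<rho> i f = \<rho> N f" using assms(1) by (auto simp: stable_def)
  obtain \<gamma> where \<gamma>: "\<rho> N f = Fin \<gamma>" using chain_finite[OF assms(2), of N] by (cases "\<rho> N f") auto
  then have "\<gamma> \<in> \<Gamma>" using N[of "Suc N"] by (intro \<Gamma>_chain[of N f]) simp
  moreover have "\<forall>\<^sub>F j in sequentially. \<rho> j f = Fin \<gamma>"
    unfolding eventually_sequentially using N \<gamma> by auto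
  ultimately show ?thesis using that by blast
qed

end

context unbounded_chain
begin

text \<open>
  The value \<open>\<rho>\<^sub>j(\<phi>)\<close> is eliminated by comparing two weights of \<open>\<phi>(x + y)\<close>: if \<open>\<partial>\<^sub>k \<phi> \<noteq> 0\<close> for some \<open>k\<close> with
  \<open>1 \<le> k < n = t b\<close>, then \<open>(n - k)\<close> times the weight of \<open>y\<close> is bounded by the difference of the stable values
  of \<open>\<partial>\<^sub>k \<phi>\<close> and \<open>\<partial>\<^sub>n \<phi>\<close>.  There are finitely many such differences, all in \<open>\<Gamma>\<^sub>\<infinity>\<close>, whereas the weight is
  unbounded.
\<close>

lemma t_index_times_b_eq_mult_order:
  assumes b: "0 < b" and c: "c \<in> \<Gamma>" 
    and bound: "\<And>a e. degree a < m \<Longrightarrow> \<rho> 0 a \<le> \<rho> 0 (hasse e a) + Fin (nmult e c)"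
    and \<delta>: "\<delta> \<in> \<Gamma>" "\<forall>\<^sub>F j in sequentially. \<rho> 0 (hasse b (\<chi> j)) = Fin \<delta>"
    and dom: "\<forall>\<^sub>F j in sequentially. \<forall>e. 0 < e \<longrightarrow> e \<noteq> b \<longrightarrow>
       Fin (nmult b (\<beta> j)) < nmult b (\<rho> 0 (hasse e (\<chi> j))) + Fin (nmult e (\<beta> j - \<delta>))"
    and \<phi>: "\<not> stable \<rho> \<phi>" "\<And>f. degree f < degree \<phi> \<Longrightarrow> stable \<rho> f"
  shows "\<forall>\<^sub>F j in sequentially. t_index (\<rho> j) (\<chi> j) \<phi> * b = mult_order \<phi>"
proof -
  define B where "B = {e. 0 < e \<and> hasse e \<phi> \<noteq> 0}"
  have "e \<le> degree \<phi>" if "e \<in> B" for e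
    using that hasse_degree[of e \<phi>] by (auto simp: B_def)
  then have "B \<subseteq> {..degree \<phi>}" by blast
  then have B_fin: "finite B" by (rule finite_subset) simp
  have "\<exists>\<gamma>\<in>\<Gamma>. \<forall>\<^sub>F j in sequentially. \<rho> j (hasse e \<phi>) = Fin \<gamma>" if e: "e \<in> B" for e
  proof -
    have "0 < degree \<phi>" using e hasse_degree[of e \<phi>] by (auto simp: B_def)
    then have "stable \<rho> (hasse e \<phi>)" using e by (intro \<phi>(2) hasse_degree_less) (auto simp: B_def)
    moreover have "hasse e \<phi> \<noteq> 0" using e by (simp add: B_def)
    ultimately obtain g where "g \<in> \<Gamma>" "\<forall>\<^sub>F j in sequentially. \<rho> j (hasse e \<phi>) = Fin g"
      by (rule stable_value_in_\<Gamma>)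
    then show ?thesis by (rule bexI[rotated])
  qed
  then have "\<exists>\<gamma>. \<forall>e\<in>B. \<gamma> e \<in> \<Gamma> \<and> (\<forall>\<^sub>F j in sequentially. \<rho> j (hasse e \<phi>) = Fin (\<gamma> e))"
    by (intro bchoice) blast
  then obtain \<gamma> where \<gamma>: "\<And>e. e \<in> B \<Longrightarrow> \<gamma> e \<in> \<Gamma>"
    "\<And>e. e \<in> B \<Longrightarrow> \<forall>\<^sub>F j in sequentially. \<rho> j (hasse e \<phi>) = Fin (\<gamma> e)"
    by blast
  have "\<forall>\<^sub>F j in sequentially. \<forall>e\<in>B. \<rho> j (hasse e \<phi>) = Fin (\<gamma> e)"
    by (intro eventually_ball_finite B_fin ballI \<gamma>(2))
  moreover have "\<forall>\<^sub>F j in sequentially. \<forall>e\<in>B. \<forall>e'\<in>B. nmult b (\<gamma> e) - nmult b (\<gamma> e') + \<delta> < \<beta> j"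
    by (intro eventually_ball_finite B_fin ballI eventually_\<beta>_gt \<Gamma>_add \<Gamma>_diff \<Gamma>_nmult \<gamma>(1) \<delta>(1))
  moreover have "\<forall>\<^sub>F j in sequentially. nmult b c + \<delta> < \<beta> j" "\<forall>\<^sub>F j in sequentially. \<delta> < \<beta> j"
    by (intro eventually_\<beta>_gt \<Gamma>_add \<Gamma>_nmult \<delta>(1) c)+
  ultimately show ?thesis using \<delta>(2) dom eventually_ge_at_top[of 1]
  proof eventually_elim
    case (elim j)
    then obtain i where j: "j = Suc i" by (cases j) auto
    let ?\<eta> = "\<beta> j - \<delta>"
    define n where "n = t_index (\<rho> j) (\<chi> j) \<phi> * b"
    obtain v where v: "\<rho> j \<phi> = Fin v"
      using chain_finite[OF unstable_nonzero[OF \<phi>(1)], of j] by (cases "\<rho> j \<phi>") auto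
    have lm: "last_min (\<lambda>f. nmult b (\<rho> j f)) ?\<eta> (taylor \<phi>) (nmult b v) n"
      unfolding n_def j
    proof (rule last_min_taylor[where c = c])
      show "0 < b" by (rule b)
      show "\<rho> 0 a \<le> \<rho> 0 (hasse e a) + Fin (nmult e c)" if "degree a < m" for a e
        using that by (rule bound)
      show "nmult b c < \<beta> (Suc i) - \<delta>" using elim(3) unfolding j by (simp only: less_diff_eq)
      show "\<rho> 0 (hasse b (\<chi> (Suc i))) = Fin \<delta>" using elim(5) unfolding j .
      show "\<rho> (Suc i) \<phi> = Fin v" using v unfolding j .
      show "Fin (nmult b (\<beta> (Suc i)))
        < nmult b (\<rho> 0 (hasse e (\<chi> (Suc i)))) + Fin (nmult e (\<beta> (Suc i) - \<delta>))"
        if "0 < e" "e \<noteq> b" for e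
        using elim(6)[rule_format, OF that] unfolding j .
    qed
    then have weight_n: "nmult b (\<rho> j (hasse n \<phi>)) + Fin (nmult n ?\<eta>) = Fin (nmult b v)"
      unfolding last_min_def weight_def coeff_taylor by blast
    have "hasse n \<phi> \<noteq> 0"
    proof
      assume "hasse n \<phi> = 0"
      then have "nmult b (\<rho> j (hasse n \<phi>)) = Infty" by (simp only: val_zero[OF valuation_chain] nmult_Infty[OF b])
      then show False using weight_n by simp
    qed
    moreover have "0 < n" using t_index_pos[OF \<phi>(1), of i] b by (simp add: n_def j)
    ultimately have n: "n \<in> B" by (simp add: B_def)
    define k where "k = mult_order \<phi>"
    have k_least: "k = (LEAST e. e \<in> B)"
      by (simp add: k_def mult_order_def B_def Suc_le_eq)
    have k: "k \<in> B" unfolding k_least using n by (rule LeastI)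
    have "k \<le> n" unfolding k_least using n by (rule Least_le)
    moreover have "\<not> k < n"
    proof
      assume "k < n"
      have \<gamma>_n: "\<rho> j (hasse n \<phi>) = Fin (\<gamma> n)" and \<gamma>_k: "\<rho> j (hasse k \<phi>) = Fin (\<gamma> k)"
        using elim(1) n k by blast+
      have "Fin (nmult b v) \<le> nmult b (\<rho> j (hasse k \<phi>)) + Fin (nmult k ?\<eta>)"
        using lm unfolding last_min_def weight_def coeff_taylor by blast
      then have le: "nmult n ?\<eta> \<le> nmult k ?\<eta> + (nmult b (\<gamma> k) - nmult b (\<gamma> n))"
        using weight_n \<gamma>_n \<gamma>_k by (simp add: nmult_Fin algebra_simps)
      have "0 \<le> ?\<eta>" using elim(4) by simp
      with le \<open>k < n\<close> have "?\<eta> \<le> nmult b (\<gamma> k) - nmult b (\<gamma> n)" by (rule nmult_le_add_imp_le)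
      moreover have "nmult b (\<gamma> k) - nmult b (\<gamma> n) + \<delta> < \<beta> j" using elim(2) n k by blast
      then have "nmult b (\<gamma> k) - nmult b (\<gamma> n) < ?\<eta>" by (simp only: less_diff_eq)
      ultimately show False by simp
    qed
    ultimately show ?case by (simp add: n_def k_def)
  qed
qed

end

context continuous_chain
begin

section \<open>Valuations above the chain\<close>

text \<open>
  The same division as for \<open>hasse_low_bound\<close>, with the roles reversed: if \<open>\<nu>\<close> increased the value of \<open>a\<close>,
  it would increase those of \<open>q a\<close> and \<open>\<chi>\<^sub>1\<close>, hence that of \<open>r\<close>, whose degree is smaller.
\<close>

lemma extension_low:
  assumes \<nu>: "valuation \<nu>" and le: "\<And>i f. \<rho> i f \<le> \<nu> f"
  shows "degree a < m \<Longrightarrow> \<nu> a = \<rho> 0 a"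
proof (induction "degree a" arbitrary: a rule: less_induct)
  case less
  show ?case
  proof (cases "degree a = 0")
    case True
    then show ?thesis by (rule val_const_le_imp_eq[OF valuation_chain \<nu> le])
  next
    case False
    then have deg_a: "0 < degree a" by simp
    define q r where "q = \<chi> (Suc 0) div a" and "r = \<chi> (Suc 0) mod a"
    have deg_r: "degree r < degree a" unfolding r_def by (rule degree_mod_lt[OF deg_a])
    have deg_q: "degree q < m"
      using degree_div_less[of "\<chi> (Suc 0)" a] deg_a m_pos by (simp add: q_def degree_key)
    have eq: "\<chi> (Suc 0) = q * a + r" by (simp add: q_def r_def)
    have deg_r': "degree r < m" using deg_r less.prems by simp
    note r = key_factor_value[OF deg_q less.prems deg_r' eq]
    have \<nu>_r: "\<nu> r = \<rho> 0 r" by (rule less.hyps[OF deg_r deg_r'])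
    show ?thesis
    proof (rule antisym[OF _ le], rule leI, rule notI)
      assume lt: "\<rho> 0 a < \<nu> a"
      have "\<rho> 0 q \<noteq> Infty" using r by (auto simp: val_mult[OF valuation_chain])
      then have "\<rho> 0 a + \<rho> 0 q < \<nu> a + \<rho> 0 q" by (intro topped_add_less_mono lt)
      also have "\<dots> \<le> \<nu> a + \<nu> q" by (intro add_left_mono le)
      finally have "\<rho> 0 r < \<nu> (q * a)"
        using r(1) by (simp add: val_mult[OF valuation_chain] val_mult[OF \<nu>] add.commute)
      moreover have "\<rho> 0 r < \<nu> (\<chi> (Suc 0))"
        using r(2) le[of "Suc 0" "\<chi> (Suc 0)"] by (simp add: val_key less_le_trans)
      ultimately have "\<rho> 0 r < \<nu> (\<chi> (Suc 0) - q * a)" by (intro val_diff_gt[OF \<nu>])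
      then show False using \<nu>_r eq by simp
    qed
  qed
qed

lemma extension_key:
  assumes \<nu>: "valuation \<nu>" and le: "\<And>i f. \<rho> i f \<le> \<nu> f"
  shows "\<nu> (\<chi> (Suc i)) = Fin (\<beta> (Suc i))"
proof -
  let ?a = "\<chi> (Suc (Suc i)) - \<chi> (Suc i)"
  have a: "\<nu> (- ?a) = Fin (\<beta> (Suc i))"
    unfolding val_minus[OF \<nu>] extension_low[OF \<nu> le degree_key_diff] by (rule val_key_diff)
  have "Fin (\<beta> (Suc i)) < Fin (\<beta> (Suc (Suc i)))" by (simp add: \<beta>_less_Suc)
  also have "\<dots> \<le> \<nu> (\<chi> (Suc (Suc i)))" using le[of "Suc (Suc i)" "\<chi> (Suc (Suc i))"] by (simp only: val_key)
  finally have "\<nu> (- ?a + \<chi> (Suc (Suc i))) = \<nu> (- ?a)"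
    unfolding a[symmetric] by (rule val_add_eq[OF \<nu>])
  then show ?thesis using a by simp
qed

text \<open>
  Only values already determined by the chain enter the slopes of \<open>\<chi>\<^sub>j\<close>, which makes \<open>b\<^sub>\<infinity>\<close> independent of
  \<open>\<nu>\<close>.
\<close>

lemma I_set_key:
  fixes i b :: nat
  assumes \<nu>: "valuation \<nu>" and le: "\<And>i f. \<rho> i f \<le> \<nu> f"
    and b: "0 < b" and \<delta>: "\<rho> 0 (hasse b (\<chi> (Suc i))) = Fin \<delta>"
    and dom: "\<And>e. 0 < e \<Longrightarrow> e \<noteq> b \<Longrightarrow> Fin (nmult b (\<beta> (Suc i)))
       < nmult b (\<rho> 0 (hasse e (\<chi> (Suc i)))) + Fin (nmult e (\<beta> (Suc i) - \<delta>))"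
  shows "I_set \<nu> (\<chi> (Suc i)) = {b}"
proof -
  let ?\<chi> = "\<chi> (Suc i)" and ?\<beta> = "\<beta> (Suc i)"
  define A where "A = {e. 1 \<le> e \<and> \<nu> (hasse e ?\<chi>) \<noteq> Infty}"
  have \<nu>_hasse: "\<nu> (hasse e ?\<chi>) = \<rho> 0 (hasse e ?\<chi>)" if "0 < e" for e
    using hasse_degree_less[OF that degree_key_pos[of i]]
    by (intro extension_low[OF \<nu> le]) (simp add: degree_key)
  have slope_b: "slope \<nu> ?\<chi> b = qdiv (?\<beta> - \<delta>) b"
    by (simp only: slope_def extension_key[OF \<nu> le] \<nu>_hasse[OF b] \<delta> topped.sel)
  have b_A: "b \<in> A" using b \<nu>_hasse[OF b] \<delta> by (simp add: A_def)
  have lt: "slope \<nu> ?\<chi> e < slope \<nu> ?\<chi> b" if eA: "e \<in> A" and eb: "e \<noteq> b" for e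
  proof -
    have e: "0 < e" using eA by (simp add: A_def)
    obtain x where x: "\<rho> 0 (hasse e ?\<chi>) = Fin x"
      using eA \<nu>_hasse[OF e] by (cases "\<rho> 0 (hasse e ?\<chi>)") (auto simp: A_def)
    have slope_e: "slope \<nu> ?\<chi> e = qdiv (?\<beta> - x) e"
      by (simp only: slope_def extension_key[OF \<nu> le] \<nu>_hasse[OF e] x topped.sel)
    have "nmult b ?\<beta> < nmult b x + nmult e (?\<beta> - \<delta>)"
      using dom[OF e eb] by (simp only: x nmult_Fin plus_topped.simps Fin_less_iff)
    then have "\<not> nmult e (?\<beta> - \<delta>) \<le> nmult b (?\<beta> - x)"
      by (simp add: nmult_diff_right algebra_simps)
    then show ?thesis unfolding slope_b slope_e not_le[symmetric] by (simp only: qdiv_le_iff[OF b e] not_False_eq_True)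
  qed
  have "e \<le> m" if "e \<in> A" for e
  proof -
    have "hasse e ?\<chi> \<noteq> 0" using that val_zero[OF \<nu>] by (auto simp: A_def)
    then show ?thesis using hasse_degree[of e ?\<chi>] by (simp add: degree_key)
  qed
  then have "A \<subseteq> {..m}" by blast
  then have "finite A" by (rule finite_subset) simp
  have "slope \<nu> ?\<chi> e \<le> slope \<nu> ?\<chi> b" if "e \<in> A" for e
    using lt[OF that] by (cases "e = b") (auto simp: less_imp_le)
  then have eps: "epsilon \<nu> ?\<chi> = slope \<nu> ?\<chi> b"
    unfolding epsilon_def A_def[symmetric] using \<open>finite A\<close> b_A by (intro Max_eqI) auto
  have "I_set \<nu> ?\<chi> = {e \<in> A. slope \<nu> ?\<chi> e = slope \<nu> ?\<chi> b}"
    unfolding I_set_def eps A_def by auto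
  also have "\<dots> = {b}" using b_A lt by fastforce
  finally show ?thesis .
qed

lemma multiple_unstable_strict:
  assumes "\<not> stable \<rho> \<phi>" "q \<noteq> 0"
  shows "\<rho> i (q * \<phi>) < \<rho> (Suc i) (q * \<phi>)"
proof -
  have "\<rho> i \<phi> + \<rho> i q < \<rho> (Suc i) \<phi> + \<rho> i q"
    by (intro topped_add_less_mono unstable_strict assms chain_finite)
  also have "\<dots> \<le> \<rho> (Suc i) \<phi> + \<rho> (Suc i) q" by (intro add_left_mono chain_mono_Suc)
  finally show ?thesis by (simp add: val_mult[OF valuation_chain] add.commute)
qed

lemma multiple_not_eventually_const:
  assumes "\<not> stable \<rho> \<phi>" "\<forall>\<^sub>F i in sequentially. \<rho> i (q * \<phi>) = v" shows "q = 0"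
proof (rule ccontr)
  assume q: "q \<noteq> 0"
  obtain N where N: "\<And>i. i \<ge> N \<Longrightarrow> \<rho> i (q * \<phi>) = v"
    using assms(2) by (auto simp: eventually_sequentially)
  then show False using multiple_unstable_strict[OF assms(1) q, of N] N[of N] N[of "Suc N"] by simp
qed

text \<open>
  The stable value of the remainder modulo a limit key polynomial.  Such a valuation is needed because
  \<open>b_inf\<close> is determined by a condition on all valuations above the chain, which would hold for every
  positive \<open>b\<close> if there were none.
\<close>

definition limit_extension :: "'a poly \<Rightarrow> 'a poly \<Rightarrow> 'g topped" where
  "limit_extension \<phi> f = (THE v. \<forall>\<^sub>F i in sequentially. \<rho> i (f mod \<phi>) = v)"

context
  fixes \<phi> assumes \<phi>: "\<not> stable \<rho> \<phi>" and below: "\<And>f. degree f < degree \<phi> \<Longrightarrow> stable \<rho> f"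
    and deg_\<phi>: "0 < degree \<phi>"
begin

lemma eventually_limit_extension: "\<forall>\<^sub>F i in sequentially. \<rho> i (f mod \<phi>) = limit_extension \<phi> f"
proof -
  have "stable \<rho> (f mod \<phi>)" by (intro below degree_mod_lt[OF deg_\<phi>])
  then obtain N where ev: "\<forall>\<^sub>F i in sequentially. \<rho> i (f mod \<phi>) = \<rho> N (f mod \<phi>)"
    unfolding stable_def eventually_sequentially by blast
  have "limit_extension \<phi> f = \<rho> N (f mod \<phi>)"
    unfolding limit_extension_def
  proof (rule the_equality)
    show "\<forall>\<^sub>F i in sequentially. \<rho> i (f mod \<phi>) = \<rho> N (f mod \<phi>)" by (rule ev)
    fix v assume "\<forall>\<^sub>F i in sequentially. \<rho> i (f mod \<phi>) = v"
    with ev have "\<forall>\<^sub>F i in sequentially. v = \<rho> N (f mod \<phi>)" by eventually_elim simp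
    then show "v = \<rho> N (f mod \<phi>)" by simp
  qed
  with ev show ?thesis by (simp only:)
qed

text \<open>
  If \<open>f\<close> and \<open>r\<close> have different stable values, then \<open>f - r\<close> is stable too, whereas nonzero multiples of
  \<open>\<phi>\<close> are not.
\<close>

lemma remainder_same_stable_value:
  assumes "\<forall>\<^sub>F i in sequentially. \<rho> i f = v" "\<forall>\<^sub>F i in sequentially. \<rho> i r = w"
    and eq: "f = q * \<phi> + r"
  shows "v = w"
proof (rule ccontr)
  assume "v \<noteq> w"
  have "\<forall>\<^sub>F i in sequentially. \<rho> i (q * \<phi>) = min v w"
    using assms(1,2)
  proof eventually_elim
    case (elim i)
    show ?case
    proof (cases "v < w")
      case True
      then have "\<rho> i (f + - r) = \<rho> i f"
        using elim by (intro val_add_eq[OF valuation_chain]) (simp add: val_minus[OF valuation_chain])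
      then show ?thesis using eq elim True by (simp add: min_absorb1 less_imp_le)
    next
      case False
      with \<open>v \<noteq> w\<close> have "w < v" by simp
      then have "\<rho> i (- r + f) = \<rho> i (- r)"
        using elim by (intro val_add_eq[OF valuation_chain]) (simp add: val_minus[OF valuation_chain])
      then show ?thesis using eq elim \<open>w < v\<close>
        by (simp add: min_absorb2 less_imp_le val_minus[OF valuation_chain])
    qed
  qed
  then have "f = r" using multiple_not_eventually_const[OF \<phi>] eq by simp
  have "\<forall>\<^sub>F i in sequentially. v = w"
    using assms(1,2) by eventually_elim (simp add: \<open>f = r\<close>)
  then show False using \<open>v \<noteq> w\<close> by simp
qed

lemma valuation_limit_extension: "valuation (limit_extension \<phi>)"
  unfolding valuation_def
proof (intro conjI allI)
  fix f g
  let ?f = "f mod \<phi>" and ?g = "g mod \<phi>"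
  have "\<forall>\<^sub>F i in sequentially. \<rho> i (?f * ?g) = limit_extension \<phi> f + limit_extension \<phi> g"
    using eventually_limit_extension[of f] eventually_limit_extension[of g]
    by eventually_elim (simp add: val_mult[OF valuation_chain])
  moreover have "?f * ?g = ((?f * ?g) div \<phi>) * \<phi> + (f * g) mod \<phi>"
    by (simp add: mod_mult_eq[symmetric, of f g])
  ultimately show "limit_extension \<phi> (f * g) = limit_extension \<phi> f + limit_extension \<phi> g"
    using remainder_same_stable_value[OF _ eventually_limit_extension] by metis
  have "\<forall>\<^sub>F i in sequentially.
      min (limit_extension \<phi> f) (limit_extension \<phi> g) \<le> limit_extension \<phi> (f + g)"
    using eventually_limit_extension[of f] eventually_limit_extension[of g] eventually_limit_extension[of "f + g"]
  proof eventually_elim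
    case (elim i)
    then show ?case using val_add[OF valuation_chain, of i ?f ?g] by (simp add: poly_mod_add_left)
  qed
  then show "min (limit_extension \<phi> f) (limit_extension \<phi> g) \<le> limit_extension \<phi> (f + g)" by simp
next
  fix a :: 'a
  have "\<forall>\<^sub>F i in sequentially. (limit_extension \<phi> [:a:] = Infty) = (a = 0)"
    using eventually_limit_extension[of "[:a:]"]
  proof eventually_elim
    case (elim i)
    then have "limit_extension \<phi> [:a:] = \<rho> i [:a:]" using deg_\<phi> by (simp add: mod_poly_less)
    then show ?case by (simp add: val_const[OF valuation_chain])
  qed
  then show "(limit_extension \<phi> [:a:] = Infty) = (a = 0)" by simp
qed

lemma chain_le_limit_extension: "\<rho> i f \<le> limit_extension \<phi> f"
proof (rule ccontr)
  let ?v = "limit_extension \<phi> f" and ?r = "f mod \<phi>"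
  assume "\<not> \<rho> i f \<le> ?v"
  then have lt: "?v < \<rho> i f" by simp
  have "\<forall>\<^sub>F k in sequentially. \<rho> k ((f div \<phi>) * \<phi>) = ?v"
    using eventually_limit_extension[of f] eventually_ge_at_top[of i]
  proof eventually_elim
    case (elim k)
    have "?v < \<rho> k f" using lt chain_mono[OF elim(2)] by (rule less_le_trans)
    then have "\<rho> k (- ?r + f) = \<rho> k (- ?r)"
      using elim by (intro val_add_eq[OF valuation_chain]) (simp add: val_minus[OF valuation_chain])
    moreover have "- ?r + f = (f div \<phi>) * \<phi>" by (simp add: minus_mod_eq_div_mult[symmetric])
    ultimately show ?case using elim by (simp add: val_minus[OF valuation_chain])
  qed
  then have "f div \<phi> = 0" by (rule multiple_not_eventually_const[OF \<phi>])
  then have r: "?r = f" using div_mult_mod_eq[of f \<phi>] by simp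
  have "\<forall>\<^sub>F k in sequentially. False"
    using eventually_limit_extension[of f] eventually_ge_at_top[of i]
  proof eventually_elim
    case (elim k)
    then show ?case using lt chain_mono[OF elim(2), of f] r by simp
  qed
  then show False by simp
qed

lemma chain_less_limit_extension: "\<rho> i < limit_extension \<phi>"
proof -
  have "\<forall>\<^sub>F i in sequentially. limit_extension \<phi> \<phi> = Infty"
    using eventually_limit_extension[of \<phi>] by eventually_elim (simp add: val_zero[OF valuation_chain])
  then have "limit_extension \<phi> \<phi> = Infty" by simp
  moreover have "\<rho> i \<phi> \<noteq> Infty" by (intro chain_finite unstable_nonzero \<phi>)
  ultimately have "\<not> limit_extension \<phi> \<phi> \<le> \<rho> i \<phi>" by simp
  then show ?thesis using chain_le_limit_extension by (simp add: less_le_not_le le_fun_def) blast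
qed

end

text \<open>
  A stable \<open>g = \<phi>' - \<phi>\<close> has eventually a larger value than \<open>\<phi>\<close>, for otherwise \<open>\<phi>' = \<phi> + g\<close> would be stable.
  Then every term in the expansion of \<open>g\<close> is too large to influence the terms of minimal value.
\<close>

lemma t_index_eventually_eq:
  assumes \<phi>: "\<not> stable \<rho> \<phi>" and \<phi>': "\<not> stable \<rho> \<phi>'" and g: "stable \<rho> (\<phi>' - \<phi>)"
  shows "\<forall>\<^sub>F j in sequentially. t_index (\<rho> j) (\<chi> j) \<phi>' = t_index (\<rho> j) (\<chi> j) \<phi>"
proof -
  define g where "g = \<phi>' - \<phi>"
  have \<phi>'_eq: "\<phi>' = \<phi> + g" by (simp add: g_def)
  obtain N where N: "\<And>i. i \<ge> N \<Longrightarrow> \<rho> i g = \<rho> N g" using g by (auto simp: stable_def g_def)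
  have lt: "\<rho> k \<phi> < \<rho> k g" if k: "N \<le> k" for k
  proof (rule ccontr)
    assume "\<not> \<rho> k \<phi> < \<rho> k g"
    then have "\<rho> N g < \<rho> (Suc k) \<phi>" using unstable_strict[OF \<phi>, of k] N[OF k] by simp
    then have "\<rho> i (g + \<phi>) = \<rho> N g" if "Suc k \<le> i" for i
      using N[of i] val_add_eq[OF valuation_chain, of i g \<phi>] chain_mono[OF that, of \<phi>] that k
      by (simp add: less_le_trans)
    then have "stable \<rho> (g + \<phi>)" unfolding stable_def by (metis order_refl)
    then show False using \<phi>' by (simp add: \<phi>'_eq add.commute)
  qed
  have "t_index (\<rho> j) (\<chi> j) \<phi>' = t_index (\<rho> j) (\<chi> j) \<phi>" if "Suc N \<le> j" for j
  proof -
    from that obtain i where j: "j = Suc i" by (cases j) auto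
    have gt: "\<rho> j \<phi> < \<rho> j g" using that by (intro lt) simp
    then have val: "\<rho> j \<phi>' = \<rho> j \<phi>" unfolding \<phi>'_eq by (rule val_add_eq[OF valuation_chain])
    define T where "T f s = coeff (expansion (\<chi> j) f) s * \<chi> j ^ s" for f s
    have T: "T \<phi>' s = T \<phi> s + T g s" for s
      unfolding T_def \<phi>'_eq j expansion_add[OF degree_key_pos] by (simp add: algebra_simps)
    have T_g: "\<rho> j \<phi> < \<rho> j (T g s)" for s
      using gt chain_le_term[of i g s] unfolding T_def j by (rule less_le_trans)
    have T_\<phi>: "\<rho> j \<phi> \<le> \<rho> j (T \<phi> s)" for s
      using chain_le_term[of i \<phi> s] unfolding T_def j .
    have "\<rho> j (T \<phi>' s) = \<rho> j \<phi> \<longleftrightarrow> \<rho> j (T \<phi> s) = \<rho> j \<phi>" for s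
    proof (cases "\<rho> j (T \<phi> s) = \<rho> j \<phi>")
      case True
      then have "\<rho> j (T \<phi> s + T g s) = \<rho> j (T \<phi> s)"
        using T_g[of s] by (intro val_add_eq[OF valuation_chain]) simp
      then show ?thesis using True by (simp add: T)
    next
      case False
      then have "\<rho> j \<phi> < \<rho> j (T \<phi> s)" using T_\<phi>[of s] by simp
      then have "\<rho> j \<phi> < \<rho> j (T \<phi> s + T g s)" using T_g by (rule val_add_gt[OF valuation_chain])
      then show ?thesis using False by (simp add: T)
    qed
    then show ?thesis unfolding t_index_def val T_def by simp
  qed
  then show ?thesis unfolding eventually_sequentially by blast
qed

end

lemma KP_infD:
  fixes \<rho> :: "nat \<Rightarrow> 'a::field poly \<Rightarrow> 'g::linordered_ab_group_add topped"
  assumes "\<phi> \<in> KP_inf \<rho>"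
  shows "\<not> stable \<rho> \<phi>" "\<And>f. degree f < degree \<phi> \<Longrightarrow> stable \<rho> f" "lead_coeff \<phi> = 1"
    "m_inf \<rho> = enat (degree \<phi>)"
proof -
  show "\<not> stable \<rho> \<phi>" "lead_coeff \<phi> = 1" and deg: "m_inf \<rho> = enat (degree \<phi>)"
    using assms by (auto simp: KP_inf_def)
  fix f :: "'a poly" assume f: "degree f < degree \<phi>"
  show "stable \<rho> f"
  proof (rule ccontr)
    assume "\<not> stable \<rho> f"
    then have "m_inf \<rho> \<le> enat (degree f)" unfolding m_inf_def by (intro INF_lower) simp
    then show False using f deg by simp
  qed
qed

section \<open>The theorem\<close>

theorem theorem4p11:
  fixes \<rho> :: "nat \<Rightarrow> 'a::field poly \<Rightarrow> 'g::linordered_ab_group_add topped"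
    and \<chi> :: "nat \<Rightarrow> 'a poly" and \<beta> :: "nat \<Rightarrow> 'g" and m :: nat
  assumes "essential_chain \<rho> \<chi> \<beta> m"
    and "\<not> (\<exists>\<gamma>\<in>stable_value_group \<rho>. \<forall>i\<ge>1. \<beta> i \<le> \<gamma>)"
  shows "\<forall>\<phi>\<in>KP_inf \<rho>. t_inf \<rho> \<chi> * b_inf \<rho> \<chi> = mult_order \<phi>"
proof
  interpret unbounded_chain \<rho> \<chi> \<beta> m
    using assms by unfold_locales (simp_all add: essential_chain_def)
  fix \<phi> assume \<phi>: "\<phi> \<in> KP_inf \<rho>"
  note \<phi>_props = KP_infD[OF \<phi>]
  have deg_\<phi>: "0 < degree \<phi>"
    using assms(1) \<phi>_props(4) by (simp add: essential_chain_def)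
  obtain c where c: "c \<in> \<Gamma>" "0 \<le> c"
    and bound: "\<And>a e. degree a < m \<Longrightarrow> \<rho> 0 a \<le> \<rho> 0 (hasse e a) + Fin (nmult e c)"
    using hasse_low_bound by blast
  obtain b \<delta> where b: "0 < b" and \<delta>: "\<delta> \<in> \<Gamma>" "\<forall>\<^sub>F j in sequentially. \<rho> 0 (hasse b (\<chi> j)) = Fin \<delta>"
    and dom: "\<forall>\<^sub>F j in sequentially. \<forall>e. 0 < e \<longrightarrow> e \<noteq> b \<longrightarrow>
       Fin (nmult b (\<beta> j)) < nmult b (\<rho> 0 (hasse e (\<chi> j))) + Fin (nmult e (\<beta> j - \<delta>))"
    by (rule key_hasse_dominance[OF c bound])
  have I: "\<forall>\<^sub>F j in sequentially. I_set \<nu> (\<chi> j) = {b}"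
    if \<nu>: "valuation \<nu>" "\<forall>i. \<rho> i < \<nu>" for \<nu> :: "'a poly \<Rightarrow> 'g topped"
    using \<delta>(2) dom eventually_ge_at_top[of 1]
  proof eventually_elim
    case (elim j)
    then obtain i where j: "j = Suc i" by (cases j) auto
    have "\<rho> i f \<le> \<nu> f" for i f using \<nu>(2) by (simp add: less_le_not_le le_fun_def)
    from I_set_key[OF \<nu>(1) this b, of i \<delta>] elim(1,2) show ?case unfolding j by blast
  qed
  \<comment> \<open>The defining condition of \<open>b_inf\<close> determines \<open>b\<close> since \<open>limit_extension \<phi>\<close> is one of the valuations.\<close>
  have "b_inf \<rho> \<chi> = b"
    unfolding b_inf_def
  proof (rule the_equality)
    fix b'
    assume "0 < b' \<and> (\<forall>\<nu> :: 'a poly \<Rightarrow> 'g topped. valuation \<nu> \<and> (\<forall>i. \<rho> i < \<nu>) \<longrightarrow>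
      (\<forall>\<^sub>F j in sequentially. I_set \<nu> (\<chi> j) = {b'}))"
    note b' = this
    note ext = valuation_limit_extension[OF \<phi>_props(1,2) deg_\<phi>]
      chain_less_limit_extension[OF \<phi>_props(1,2) deg_\<phi>]
    from b' ext have "\<forall>\<^sub>F j in sequentially. I_set (limit_extension \<phi>) (\<chi> j) = {b'}" by blast
    moreover have "\<forall>\<^sub>F j in sequentially. I_set (limit_extension \<phi>) (\<chi> j) = {b}"
      using I ext by blast
    ultimately have "\<forall>\<^sub>F j :: nat in sequentially. b' = b" by eventually_elim simp
    then show "b' = b" by simp
  qed (use b I in blast)
  moreover have t_b: "\<forall>\<^sub>F j in sequentially. t_index (\<rho> j) (\<chi> j) \<phi> * b = mult_order \<phi>"
    by (rule t_index_times_b_eq_mult_order[OF b c(1) bound \<delta> dom \<phi>_props(1,2)])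
  have t: "\<forall>\<^sub>F j in sequentially. t_index (\<rho> j) (\<chi> j) \<phi> = mult_order \<phi> div b"
    using t_b
  proof eventually_elim
    case (elim j)
    show ?case using b by (simp flip: elim)
  qed
  have t': "\<forall>\<^sub>F j in sequentially. t_index (\<rho> j) (\<chi> j) \<phi>' = mult_order \<phi> div b"
    if \<phi>': "\<phi>' \<in> KP_inf \<rho>" for \<phi>'
  proof -
    note \<phi>'_props = KP_infD[OF \<phi>']
    have deg: "degree \<phi>' = degree \<phi>" using \<phi>_props(4) \<phi>'_props(4) by simp
    have "degree (\<phi>' - \<phi>) < degree \<phi>"
    proof -
      have "degree (\<phi>' - \<phi>) \<le> degree \<phi>" by (intro degree_diff_le) (simp_all add: deg)
      moreover have "coeff (\<phi>' - \<phi>) (degree \<phi>) = 0" using \<phi>_props(3) \<phi>'_props(3) deg by simp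
      ultimately show ?thesis using deg_\<phi> by (metis degree_0 leading_coeff_0_iff order_le_less)
    qed
    then have "\<forall>\<^sub>F j in sequentially. t_index (\<rho> j) (\<chi> j) \<phi>' = t_index (\<rho> j) (\<chi> j) \<phi>"
      by (intro t_index_eventually_eq \<phi>_props \<phi>'_props)
    with t show ?thesis by eventually_elim simp
  qed
  have "t_inf \<rho> \<chi> = mult_order \<phi> div b"
    unfolding t_inf_def
  proof (rule the_equality)
    fix t assume "\<forall>\<phi>\<in>KP_inf \<rho>. \<forall>\<^sub>F j in sequentially. t_index (\<rho> j) (\<chi> j) \<phi> = t"
    then have "\<forall>\<^sub>F j in sequentially. t_index (\<rho> j) (\<chi> j) \<phi> = t" using \<phi> by blast
    with t have "\<forall>\<^sub>F j :: nat in sequentially. t = mult_order \<phi> div b" by eventually_elim simp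
    then show "t = mult_order \<phi> div b" by simp
  qed (use t' in blast)
  moreover have "mult_order \<phi> div b * b = mult_order \<phi>"
  proof -
    have "\<forall>\<^sub>F j :: nat in sequentially. mult_order \<phi> div b * b = mult_order \<phi>"
      using t t_b by eventually_elim simp
    then show ?thesis by simp
  qed
  ultimately show "t_inf \<rho> \<chi> * b_inf \<rho> \<chi> = mult_order \<phi>" by simp
qed

end
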